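(* Let $G=(V,E)$ be a graph and let $P:V\to\mathbb{R}^\ell$ be a vector representation of $G$. Then, for every $f:V\to\mathbb{R}_{\geq0}$ and every $k\geq 0$, \[ \dim\big(\tilde H_k(I(G);\mathbb{R})\big)\leq\Big|\Big\{I\subseteq V,\ |I|=k+1:\ \Big(\sum_{u\in I}P(u)\Big)\cdot\Big(\sum_{v\in V}f(v)P(v)\Big)\geq\sum_{v\in V}f(v)\Big\}\Big|. \]
   Context: The independence complex $I(G)$ is the simplicial complex on $V$ whose simplices are the independent sets of $G$; $\tilde H_k(\cdot;\mathbb{R})$ is reduced homology with real coefficients. A map $P:V\to\mathbb{R}^\ell$ (for some $\ell\geq1$) is a vector representation of $G$ if for all $u,v\in V$ (including $u=v$) one has $P(u)\cdot P(v)\geq 1$ if $\{u,v\}\in E$ and $P(u)\cdot P(v)\geq 0$ otherwise. *)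

theory Defs
  imports
    "HOL-Analysis.Analysis"
    "HOL-Combinatorics.Permutations"
    "HOL-Algebra.AbelCoset"
    "Jordan_Normal_Form.VS_Connect"
begin

section \<open>Graphs, independence complexes and vector representations\<close>

definition simple_graph :: "'a set \<Rightarrow> 'a set set \<Rightarrow> bool" where
  "simple_graph V E \<longleftrightarrow> finite V \<and> (\<forall>e\<in>E. e \<subseteq> V \<and> card e = 2)"

text \<open>The empty set is a simplex of the independence complex, which is what makes the homology
  below reduced.\<close>

definition independence_complex :: "'a set \<Rightarrow> 'a set set \<Rightarrow> 'a set set" where
  "independence_complex V E = {S. S \<subseteq> V \<and> (\<forall>u\<in>S. \<forall>v\<in>S. {u, v} \<notin> E)}"

definition vector_representation ::
    "'a set \<Rightarrow> 'a set set \<Rightarrow> ('a \<Rightarrow> real ^ 'l) \<Rightarrow> bool" where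
  "vector_representation V E P \<longleftrightarrow>
     (\<forall>u\<in>V. \<forall>v\<in>V. if {u, v} \<in> E then inner (P u) (P v) \<ge> 1 else inner (P u) (P v) \<ge> 0)"


section \<open>Reduced simplicial homology with real coefficients\<close>

text \<open>A chain is a finitely supported real function on ordered simplices (repetition-free lists of
  vertices spanning a simplex) that changes by the sign of the permutation when the vertices are
  permuted. The oriented simplex \<open>[x\<^sub>0,\<dots>,x\<^sub>k]\<close> is the chain whose value at a reordering of
  \<open>x\<^sub>0,\<dots>,x\<^sub>k\<close> is the sign of that reordering, and \<open>0\<close> elsewhere. The index \<open>n\<close> counts vertices,
  so \<open>oriented_chains K (k + 1)\<close> is the space of \<open>k\<close>-chains and \<open>oriented_chains K 0\<close> that of
  \<open>(-1)\<close>-chains. A \<open>module\<close> record also has ring fields \<open>mult\<close> and \<open>one\<close>; they carry no information here.\<close>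

definition oriented_chains :: "'a set set \<Rightarrow> nat \<Rightarrow> (real, 'a list \<Rightarrow> real) module" where
  "oriented_chains K n =
    \<lparr>carrier = {c. finite {xs. c xs \<noteq> 0} \<and>
        (\<forall>xs. c xs \<noteq> 0 \<longrightarrow> length xs = n \<and> distinct xs \<and> set xs \<in> K) \<and>
        (\<forall>xs p. p permutes {..<length xs} \<longrightarrow> c (permute_list p xs) = of_int (sign p) * c xs)},
     mult = (\<lambda>c d. undefined), one = undefined,
     zero = (\<lambda>xs. 0), add = (\<lambda>c d xs. c xs + d xs),
     smult = (\<lambda>r c xs. r * c xs)\<rparr>"

text \<open>The coefficient of \<open>[y\<^sub>1,\<dots>,y\<^sub>k]\<close> in the boundary of \<open>c\<close> collects the coefficients
  of all \<open>[v,y\<^sub>1,\<dots>,y\<^sub>k]\<close>. On oriented simplices this is the usual alternating sum, since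
  \<open>[x\<^sub>0,\<dots>,x\<^sub>k]\<close> takes the value \<open>(-1)^i\<close> at the list obtained by moving \<open>x\<^sub>i\<close> to the front.
  On \<open>0\<close>-chains it is the augmentation: its value at the empty list is the sum of all the
  values of the chain.\<close>

definition boundary :: "('a list \<Rightarrow> real) \<Rightarrow> ('a list \<Rightarrow> real)" where
  "boundary c = (\<lambda>ys. \<Sum>v | c (v # ys) \<noteq> 0. c (v # ys))"

definition cycles :: "'a set set \<Rightarrow> nat \<Rightarrow> ('a list \<Rightarrow> real) set" where
  "cycles K n = {c \<in> carrier (oriented_chains K n). boundary c = (\<lambda>xs. 0)}"

definition boundaries :: "'a set set \<Rightarrow> nat \<Rightarrow> ('a list \<Rightarrow> real) set" where
  "boundaries K n = boundary ` carrier (oriented_chains K (Suc n))"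

definition quotient_module ::
    "('r, 'm, 'x) module_scheme \<Rightarrow> 'm set \<Rightarrow> ('r, 'm set) module" where
  "quotient_module M N =
    \<lparr>carrier = A_RCOSETS M N,
     mult = (\<lambda>X Y. undefined), one = undefined,
     zero = N, add = set_add M,
     smult = (\<lambda>r X. \<Union>x\<in>X. a_r_coset M N (r \<odot>\<^bsub>M\<^esub> x))\<rparr>"

definition reduced_homology :: "'a set set \<Rightarrow> nat \<Rightarrow> (real, ('a list \<Rightarrow> real) set) module" where
  "reduced_homology K k =
     quotient_module ((oriented_chains K (k + 1))\<lparr>carrier := cycles K (k + 1)\<rparr>) (boundaries K (k + 1))"

section \<open>Well-definedness\<close>

text \<open>The dimension function of the library is meaningful on vector spaces only, so we check
  that the reduced homology of a complex is one.\<close>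

lemma chains_simps [simp]:
  "zero (oriented_chains K n) = (\<lambda>xs. 0)"
  "add (oriented_chains K n) = (\<lambda>c d xs. c xs + d xs)"
  "smult (oriented_chains K n) = (\<lambda>r c xs. r * c xs)"
  by (simp_all add: oriented_chains_def)

lemma chains_carrier_iff:
  "c \<in> carrier (oriented_chains K n) \<longleftrightarrow> finite {xs. c xs \<noteq> 0} \<and>
     (\<forall>xs. c xs \<noteq> 0 \<longrightarrow> length xs = n \<and> distinct xs \<and> set xs \<in> K) \<and>
     (\<forall>xs p. p permutes {..<length xs} \<longrightarrow> c (permute_list p xs) = of_int (sign p) * c xs)"
  by (simp add: oriented_chains_def)

lemma chains_zero: "(\<lambda>xs. 0) \<in> carrier (oriented_chains K n)"
  by (simp add: chains_carrier_iff)

lemma chains_add: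
  assumes "c \<in> carrier (oriented_chains K n)" "d \<in> carrier (oriented_chains K n)"
  shows "(\<lambda>xs. c xs + d xs) \<in> carrier (oriented_chains K n)"
proof -
  have "finite {xs. c xs + d xs \<noteq> 0}"
    by (rule finite_subset[of _ "{xs. c xs \<noteq> 0} \<union> {xs. d xs \<noteq> 0}"])
      (use assms in \<open>auto simp: chains_carrier_iff\<close>)
  moreover have "length xs = n \<and> distinct xs \<and> set xs \<in> K" if "c xs + d xs \<noteq> 0" for xs
    using that assms by (cases "c xs = 0") (auto simp: chains_carrier_iff)
  moreover have "c (permute_list p xs) + d (permute_list p xs) = of_int (sign p) * (c xs + d xs)"
    if "p permutes {..<length xs}" for p xs
    using that assms by (simp add: chains_carrier_iff distrib_left)
  ultimately show ?thesis unfolding chains_carrier_iff by blast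
qed

lemma chains_smult:
  assumes "c \<in> carrier (oriented_chains K n)"
  shows "(\<lambda>xs. r * c xs) \<in> carrier (oriented_chains K n)"
proof -
  have "finite {xs. r * c xs \<noteq> 0}"
    by (rule finite_subset[of _ "{xs. c xs \<noteq> 0}"])
      (use assms in \<open>auto simp: chains_carrier_iff\<close>)
  then show ?thesis using assms unfolding chains_carrier_iff by auto
qed

lemma finite_chain_slice:
  assumes "c \<in> carrier (oriented_chains K n)"
  shows "finite {v. c (v # ys) \<noteq> 0}"
proof -
  have "finite ((\<lambda>v. v # ys) -` {xs. c xs \<noteq> 0})"
    using assms by (intro finite_vimageI) (auto simp: chains_carrier_iff inj_def)
  then show ?thesis by (simp add: vimage_def)
qed

lemma boundary_eq_sum:
  assumes "finite A" "{v. c (v # ys) \<noteq> 0} \<subseteq> A"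
  shows "boundary c ys = (\<Sum>v\<in>A. c (v # ys))"
  unfolding boundary_def by (rule sum.mono_neutral_left) (use assms in auto)

lemma boundary_nonzero:
  assumes "boundary c ys \<noteq> 0"
  shows "\<exists>v. c (v # ys) \<noteq> 0"
  using assms by (rule contrapos_np) (simp add: boundary_def)

lemma boundary_zero: "boundary (\<lambda>xs. 0) = (\<lambda>xs. 0)"
  by (simp add: boundary_def)

lemma boundary_add:
  assumes "c \<in> carrier (oriented_chains K n)" "d \<in> carrier (oriented_chains K n)"
  shows "boundary (\<lambda>xs. c xs + d xs) = (\<lambda>xs. boundary c xs + boundary d xs)"
proof
  fix ys
  let ?A = "{v. c (v # ys) \<noteq> 0} \<union> {v. d (v # ys) \<noteq> 0}"
  have fin: "finite ?A" using assms by (simp add: finite_chain_slice)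
  have "boundary (\<lambda>xs. c xs + d xs) ys = (\<Sum>v\<in>?A. c (v # ys) + d (v # ys))"
    by (rule boundary_eq_sum[OF fin]) auto
  moreover have "boundary c ys = (\<Sum>v\<in>?A. c (v # ys))" "boundary d ys = (\<Sum>v\<in>?A. d (v # ys))"
    by (rule boundary_eq_sum[OF fin], auto)+
  ultimately show "boundary (\<lambda>xs. c xs + d xs) ys = boundary c ys + boundary d ys"
    by (simp add: sum.distrib)
qed

lemma boundary_smult: "boundary (\<lambda>xs. r * c xs) = (\<lambda>xs. r * boundary c xs)"
  by (cases "r = 0") (auto simp: boundary_def sum_distrib_left)

lemma chains_vectorspace: "vectorspace class_ring (oriented_chains K n)"
proof -
  have "abelian_group (oriented_chains K n)"
  proof (rule abelian_groupI, simp_all add: chains_add chains_zero add_ac)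
    fix c assume "c \<in> carrier (oriented_chains K n)"
    then have "(\<lambda>xs. - 1 * c xs) \<in> carrier (oriented_chains K n)" by (rule chains_smult)
    then show "\<exists>d\<in>carrier (oriented_chains K n). (\<lambda>xs. c xs + d xs) = (\<lambda>xs. 0)"
      by (intro bexI[of _ "\<lambda>xs. - 1 * c xs"]) auto
  qed
  then have "module class_ring (oriented_chains K n)"
    by (intro moduleI) (auto simp: chains_smult algebra_simps class_cring.cring_axioms)
  then show ?thesis by (simp add: vectorspace_def class_field)
qed

lemma permute_list_swap_Cons2:
  "permute_list (Transposition.transpose 0 1) (w # v # ys) = v # w # ys"
proof (rule nth_equalityI)
  fix i assume i: "i < length (permute_list (Transposition.transpose 0 1) (w # v # ys))"
  consider "i = 0" | "i = 1" | j where "i = Suc (Suc j)" by (metis One_nat_def not0_implies_Suc)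
  then show "permute_list (Transposition.transpose 0 1) (w # v # ys) ! i = (v # w # ys) ! i"
    by cases (use i in \<open>auto simp: permute_list_def Transposition.transpose_def simp del: upt_Suc\<close>)
qed simp

lemma chain_swap:
  assumes "c \<in> carrier (oriented_chains K n)"
  shows "c (v # w # ys) = - c (w # v # ys)"
proof -
  have "Transposition.transpose 0 1 permutes {..<length (w # v # ys)}"
    by (rule permutes_swap_id) auto
  then have "c (permute_list (Transposition.transpose 0 1) (w # v # ys))
      = of_int (sign (Transposition.transpose (0::nat) 1)) * c (w # v # ys)"
    using assms unfolding chains_carrier_iff by blast
  then show ?thesis unfolding permute_list_swap_Cons2 by (simp add: sign_swap_id)
qed

lemma boundary_boundary:
  assumes "c \<in> carrier (oriented_chains K n)"
  shows "boundary (boundary c) = (\<lambda>xs. 0)"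
proof
  fix ys
  let ?A = "\<Union>xs\<in>{xs. c xs \<noteq> 0}. set xs"
  have fin: "finite ?A" using assms by (auto simp: chains_carrier_iff)
  have mem: "set xs \<subseteq> ?A" if "c xs \<noteq> 0" for xs
    using that by blast
  have 1: "boundary c zs = (\<Sum>w\<in>?A. c (w # zs))" for zs
  proof (rule boundary_eq_sum[OF fin])
    show "{w. c (w # zs) \<noteq> 0} \<subseteq> ?A"
    proof
      fix w assume "w \<in> {w. c (w # zs) \<noteq> 0}"
      then have "set (w # zs) \<subseteq> ?A" by (intro mem) (rule CollectD)
      then show "w \<in> ?A" unfolding list.set by (rule insert_subset[THEN iffD1, THEN conjunct1])
    qed
  qed
  have "boundary (boundary c) ys = (\<Sum>v\<in>?A. boundary c (v # ys))"
  proof (rule boundary_eq_sum[OF fin])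
    show "{v. boundary c (v # ys) \<noteq> 0} \<subseteq> ?A"
    proof
      fix v assume "v \<in> {v. boundary c (v # ys) \<noteq> 0}"
      then obtain w where "c (w # v # ys) \<noteq> 0" using boundary_nonzero[of c "v # ys"] by blast
      then have "set (w # v # ys) \<subseteq> ?A" by (rule mem)
      then show "v \<in> ?A" by (rule subsetD) (unfold list.set, blast)
    qed
  qed
  then have "boundary (boundary c) ys = (\<Sum>v\<in>?A. \<Sum>w\<in>?A. c (w # v # ys))" by (simp only: 1)
  moreover have "(\<Sum>v\<in>?A. \<Sum>w\<in>?A. c (w # v # ys)) = (\<Sum>v\<in>?A. \<Sum>w\<in>?A. c (v # w # ys))"
    by (rule sum.swap)
  moreover have "\<dots> = - (\<Sum>v\<in>?A. \<Sum>w\<in>?A. c (w # v # ys))"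
    unfolding sum_negf[symmetric] by (intro sum.cong refl chain_swap[OF assms])
  ultimately show "boundary (boundary c) ys = 0" by linarith
qed

lemma permute_list_Cons:
  assumes "p permutes {..<length ys}"
  shows "\<exists>q. q permutes {..<length (v # ys)} \<and> sign q = sign p \<and>
    permute_list q (v # ys) = v # permute_list p ys"
proof -
  have "permutation p" using assms permutation_permutes by blast
  let ?q = "map_permutation {..<length ys} Suc p"
  have inj: "inj_on Suc {..<length ys}" by simp
  have p1: "?q permutes Suc ` {..<length ys}"
    using assms map_permutation_permutes[OF inj[THEN inj_on_imp_bij_betw] assms] by simp
  have "?q permutes {..<length (v # ys)}"
    by (rule permutes_subset[OF p1]) auto
  moreover have "sign ?q = sign p"
    by (rule sign_map_permutation[OF inj assms]) simp
  moreover have "permute_list ?q (v # ys) = v # permute_list p ys"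
  proof (rule nth_equalityI)
    fix i assume i: "i < length (permute_list ?q (v # ys))"
    show "permute_list ?q (v # ys) ! i = (v # permute_list p ys) ! i"
    proof (cases i)
      case 0
      have "?q 0 = 0" using p1 by (intro permutes_not_in[OF p1]) auto
      then show ?thesis using 0 by (simp add: permute_list_def del: upt_Suc)
    next
      case (Suc j)
      then have j: "j < length ys" using i by simp
      have "?q (Suc j) = Suc (p j)"
        using map_permutation_apply[OF inj, of j p] j by simp
      then show ?thesis using Suc j by (simp add: permute_list_def del: upt_Suc)
    qed
  qed simp
  ultimately show ?thesis by blast
qed

lemma boundary_chain:
  assumes c: "c \<in> carrier (oriented_chains K (Suc n))"
    and down: "\<And>S T. S \<in> K \<Longrightarrow> T \<subseteq> S \<Longrightarrow> T \<in> K"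
  shows "boundary c \<in> carrier (oriented_chains K n)"
proof -
  have "{ys. boundary c ys \<noteq> 0} \<subseteq> tl ` {xs. c xs \<noteq> 0}"
  proof
    fix ys assume "ys \<in> {ys. boundary c ys \<noteq> 0}"
    then obtain v where "c (v # ys) \<noteq> 0" using boundary_nonzero[of c ys] by blast
    then show "ys \<in> tl ` {xs. c xs \<noteq> 0}" by (intro image_eqI[of _ _ "v # ys"]) simp_all
  qed
  then have "finite {ys. boundary c ys \<noteq> 0}"
    by (rule finite_subset) (use c in \<open>auto simp: chains_carrier_iff\<close>)
  moreover have "length ys = n \<and> distinct ys \<and> set ys \<in> K" if nz: "boundary c ys \<noteq> 0" for ys
  proof -
    obtain v where "c (v # ys) \<noteq> 0" using boundary_nonzero[OF nz] by blast
    then have "length (v # ys) = Suc n \<and> distinct (v # ys) \<and> set (v # ys) \<in> K"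
      using c unfolding chains_carrier_iff by blast
    then show ?thesis using down[of "set (v # ys)" "set ys"] by auto
  qed
  moreover have "boundary c (permute_list p ys) = of_int (sign p) * boundary c ys"
    if p: "p permutes {..<length ys}" for ys p
  proof -
    have eq: "c (v # permute_list p ys) = of_int (sign p) * c (v # ys)" for v
      using permute_list_Cons[OF p, of v] c unfolding chains_carrier_iff by metis
    have "sign p \<noteq> 0" by (simp add: sign_def)
    then show ?thesis unfolding boundary_def eq by (simp add: sum_distrib_left)
  qed
  ultimately show ?thesis unfolding chains_carrier_iff by blast
qed

lemma quotient_module_vectorspace:
  fixes F (structure)
  assumes vs: "vectorspace F M" and sub: "subspace F N M"
  shows "vectorspace F (quotient_module M N)"
proof -
  interpret M: vectorspace F M by (rule vs)
  have subm: "LinearCombinations.submodule F N M" using sub by (simp add: VectorSpace.subspace_def)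
  have Nsub: "N \<subseteq> carrier M" using subm by (simp add: LinearCombinations.submodule_def)
  have smN: "a \<odot>\<^bsub>M\<^esub> x \<in> N" if "a \<in> carrier F" "x \<in> N" for a x
    using subm that by (simp add: LinearCombinations.submodule_def)
  interpret N: abelian_subgroup N M
  proof (rule abelian_subgroupI3)
    show "additive_subgroup N M"
      unfolding additive_subgroup_def
    proof (rule M.add.subgroupI)
      fix x assume x: "x \<in> N"
      then have "x \<in> carrier M" using Nsub by auto
      then have "\<ominus>\<^bsub>M\<^esub> x = (\<ominus>\<^bsub>F\<^esub> \<one>\<^bsub>F\<^esub>) \<odot>\<^bsub>M\<^esub> x" by (simp add: M.smult_l_minus)
      then show "\<ominus>\<^bsub>M\<^esub> x \<in> N" using smN[OF _ x] by simp
    qed (use subm in \<open>auto simp: LinearCombinations.submodule_def\<close>)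
  qed (rule M.abelian_group_axioms)
  let ?Q = "quotient_module M N"
  have car: "carrier ?Q = A_RCOSETS M N" "add ?Q = set_add M" "zero ?Q = N"
    by (simp_all add: quotient_module_def)
  have add: "set_add M (a_r_coset M N x) (a_r_coset M N y) = a_r_coset M N (x \<oplus>\<^bsub>M\<^esub> y)"
    if "x \<in> carrier M" "y \<in> carrier M" for x y
    using N.a_rcos_sum that by blast
  have sm: "r \<odot>\<^bsub>?Q\<^esub> (a_r_coset M N x) = a_r_coset M N (r \<odot>\<^bsub>M\<^esub> x)"
    if r: "r \<in> carrier F" and x: "x \<in> carrier M" for r x
  proof -
    have "a_r_coset M N (r \<odot>\<^bsub>M\<^esub> y) = a_r_coset M N (r \<odot>\<^bsub>M\<^esub> x)"
      if yx: "y \<in> a_r_coset M N x" for y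
    proof -
      obtain h where h: "h \<in> N" "y = h \<oplus>\<^bsub>M\<^esub> x" using yx by (auto simp: a_r_coset_def')
      have hc: "h \<in> carrier M" using h Nsub by auto
      have "r \<odot>\<^bsub>M\<^esub> y = r \<odot>\<^bsub>M\<^esub> h \<oplus>\<^bsub>M\<^esub> r \<odot>\<^bsub>M\<^esub> x"
        using r x h hc by (simp add: M.smult_r_distr)
      then have "r \<odot>\<^bsub>M\<^esub> y \<in> a_r_coset M N (r \<odot>\<^bsub>M\<^esub> x)"
        using smN[OF r h(1)] by (auto simp: a_r_coset_def')
      then show ?thesis using N.a_repr_independence' r x by simp
    qed
    then have "(\<Union>y\<in>a_r_coset M N x. a_r_coset M N (r \<odot>\<^bsub>M\<^esub> y)) =
        (\<Union>y\<in>a_r_coset M N x. a_r_coset M N (r \<odot>\<^bsub>M\<^esub> x))"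
      by (rule SUP_cong[OF refl])
    also have "\<dots> = a_r_coset M N (r \<odot>\<^bsub>M\<^esub> x)"
      using N.a_rcos_self[OF x] by (intro UN_constant_eq) simp_all
    finally show ?thesis by (simp add: quotient_module_def)
  qed
  have rep: "\<exists>x\<in>carrier M. X = a_r_coset M N x" if "X \<in> carrier ?Q" for X
    using that by (auto simp: car A_RCOSETS_def')
  have inQ: "a_r_coset M N x \<in> carrier ?Q" if "x \<in> carrier M" for x
    using that by (auto simp: car A_RCOSETS_def')
  have Nz: "N = a_r_coset M N \<zero>\<^bsub>M\<^esub>" using M.a_coset_add_zero[OF Nsub] by simp
  have "abelian_group ?Q"
  proof (rule abelian_groupI)
    show "\<zero>\<^bsub>?Q\<^esub> \<in> carrier ?Q" using inQ[of "\<zero>\<^bsub>M\<^esub>"] Nz by (simp add: car)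
    fix X assume X: "X \<in> carrier ?Q"
    then obtain x where x: "x \<in> carrier M" "X = a_r_coset M N x" using rep by blast
    have "\<zero>\<^bsub>?Q\<^esub> = a_r_coset M N \<zero>\<^bsub>M\<^esub>" using Nz by (simp add: car)
    then show "\<zero>\<^bsub>?Q\<^esub> \<oplus>\<^bsub>?Q\<^esub> X = X" using x by (simp add: car(2) add)
    show "\<exists>Y\<in>carrier ?Q. Y \<oplus>\<^bsub>?Q\<^esub> X = \<zero>\<^bsub>?Q\<^esub>"
      using x inQ[of "\<ominus>\<^bsub>M\<^esub> x"] Nz by (intro bexI) (auto simp: car add M.l_neg)
    fix Y assume Y: "Y \<in> carrier ?Q"
    then obtain y where y: "y \<in> carrier M" "Y = a_r_coset M N y" using rep by blast
    show "X \<oplus>\<^bsub>?Q\<^esub> Y \<in> carrier ?Q" using x y inQ by (simp add: car(2) add)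
    show "X \<oplus>\<^bsub>?Q\<^esub> Y = Y \<oplus>\<^bsub>?Q\<^esub> X" using x y by (simp add: car(2) add M.a_comm)
    fix Z assume Z: "Z \<in> carrier ?Q"
    then obtain z where z: "z \<in> carrier M" "Z = a_r_coset M N z" using rep by blast
    show "X \<oplus>\<^bsub>?Q\<^esub> Y \<oplus>\<^bsub>?Q\<^esub> Z = X \<oplus>\<^bsub>?Q\<^esub> (Y \<oplus>\<^bsub>?Q\<^esub> Z)"
      using x y z by (simp add: car(2) add M.a_assoc)
  qed
  then have "module F ?Q"
  proof (rule moduleI[OF M.R.is_cring])
    fix a b X Y
    assume a: "a \<in> carrier F" and X: "X \<in> carrier ?Q"
    then obtain x where x: "x \<in> carrier M" "X = a_r_coset M N x" using rep by blast
    show "a \<odot>\<^bsub>?Q\<^esub> X \<in> carrier ?Q" using a x inQ by (simp add: sm)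
    { assume b: "b \<in> carrier F"
      show "(a \<oplus>\<^bsub>F\<^esub> b) \<odot>\<^bsub>?Q\<^esub> X = a \<odot>\<^bsub>?Q\<^esub> X \<oplus>\<^bsub>?Q\<^esub> b \<odot>\<^bsub>?Q\<^esub> X"
        using a b x by (simp add: sm car(2) add M.smult_l_distr)
      show "a \<otimes>\<^bsub>F\<^esub> b \<odot>\<^bsub>?Q\<^esub> X = a \<odot>\<^bsub>?Q\<^esub> (b \<odot>\<^bsub>?Q\<^esub> X)"
        using a b x by (simp add: sm M.smult_assoc1) }
    assume "Y \<in> carrier ?Q"
    then obtain y where y: "y \<in> carrier M" "Y = a_r_coset M N y" using rep by blast
    show "a \<odot>\<^bsub>?Q\<^esub> (X \<oplus>\<^bsub>?Q\<^esub> Y) = a \<odot>\<^bsub>?Q\<^esub> X \<oplus>\<^bsub>?Q\<^esub> a \<odot>\<^bsub>?Q\<^esub> Y"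
      using a x y by (simp add: sm car(2) add M.smult_r_distr)
  next
    fix X assume "X \<in> carrier ?Q"
    then obtain x where x: "x \<in> carrier M" "X = a_r_coset M N x" using rep by blast
    then show "\<one>\<^bsub>F\<^esub> \<odot>\<^bsub>?Q\<^esub> X = X" by (simp add: sm)
  qed
  then show ?thesis using M.field_axioms by (simp add: vectorspace_def)
qed

theorem reduced_homology_vectorspace:
  assumes down: "\<And>S T. S \<in> K \<Longrightarrow> T \<subseteq> S \<Longrightarrow> T \<in> K"
  shows "vectorspace class_ring (reduced_homology K k)"
proof -
  let ?C = "oriented_chains K (k + 1)" and ?Z = "cycles K (k + 1)" and ?B = "boundaries K (k + 1)"
  interpret C: vectorspace class_ring ?C by (rule chains_vectorspace)
  have Z: "LinearCombinations.submodule class_ring ?Z ?C"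
    unfolding LinearCombinations.submodule_def using C.module_axioms
    by (auto simp: cycles_def chains_zero chains_add chains_smult boundary_zero boundary_add
        boundary_smult)
  have Zvs: "vectorspace class_ring (?C\<lparr>carrier := ?Z\<rparr>)"
    by (rule C.subspace_is_vs) (unfold VectorSpace.subspace_def, intro conjI Z C.vectorspace_axioms)
  interpret Z: vectorspace class_ring "?C\<lparr>carrier := ?Z\<rparr>" by (rule Zvs)
  have "LinearCombinations.submodule class_ring ?B (?C\<lparr>carrier := ?Z\<rparr>)"
    unfolding LinearCombinations.submodule_def
  proof (intro conjI allI impI)
    show "Module.module class_ring (?C\<lparr>carrier := ?Z\<rparr>)" by (rule Z.module_axioms)
    show "?B \<subseteq> carrier (?C\<lparr>carrier := ?Z\<rparr>)"
      using boundary_chain[OF _ down] boundary_boundary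
      by (fastforce simp: boundaries_def cycles_def)
    have "boundary (\<lambda>xs. 0) \<in> ?B"
      unfolding boundaries_def by (rule imageI[OF chains_zero])
    then show "\<zero>\<^bsub>?C\<lparr>carrier := ?Z\<rparr>\<^esub> \<in> ?B" by (simp add: boundary_zero)
  next
    fix b d assume "b \<in> ?B" "d \<in> ?B"
    then obtain b' d' where bd: "b = boundary b'" "d = boundary d'"
      "b' \<in> carrier (oriented_chains K (Suc (k + 1)))"
      "d' \<in> carrier (oriented_chains K (Suc (k + 1)))"
      unfolding boundaries_def by blast
    have "boundary (\<lambda>xs. b' xs + d' xs) \<in> ?B"
      unfolding boundaries_def by (rule imageI[OF chains_add[OF bd(3,4)]])
    then show "b \<oplus>\<^bsub>?C\<lparr>carrier := ?Z\<rparr>\<^esub> d \<in> ?B"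
      by (simp add: bd(1,2) boundary_add[OF bd(3,4)])
  next
    fix r :: real and b assume "b \<in> ?B"
    then obtain b' where b: "b = boundary b'" "b' \<in> carrier (oriented_chains K (Suc (k + 1)))"
      unfolding boundaries_def by blast
    have "boundary (\<lambda>xs. r * b' xs) \<in> ?B"
      unfolding boundaries_def by (rule imageI[OF chains_smult[OF b(2)]])
    then show "r \<odot>\<^bsub>?C\<lparr>carrier := ?Z\<rparr>\<^esub> b \<in> ?B"
      by (simp add: b(1) boundary_smult)
  qed
  then show ?thesis unfolding reduced_homology_def
    by (rule quotient_module_vectorspace[OF Zvs, unfolded VectorSpace.subspace_def, OF conjI[OF Zvs]])
qed

corollary independence_complex_homology_vectorspace:
  "vectorspace class_ring (reduced_homology (independence_complex V E) k)"
  by (rule reduced_homology_vectorspace) (auto simp: independence_complex_def)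

end

theory Submission
  imports Defs
begin

text \<open>
  By perturbation we may assume \<open>f > 0\<close>. Weight the chains so that, after rescaling, the boundary
  becomes the contraction \<open>\<iota>\<close> with \<open>\<omega> = \<Sum>\<^sub>v \<surd>f(v) e\<^sub>v\<close> in the exterior algebra of \<open>\<real>\<^sup>V\<close>, and its
  adjoint is the wedge product with \<open>\<omega>\<close> followed by the projection to the simplices. Since
  \<open>\<iota>(\<omega> \<and> h) + \<omega> \<and> \<iota>h = (\<Sum>\<^sub>v f(v)) h\<close>, a harmonic chain \<open>h\<close> satisfies
  \<open>(\<Sum>\<^sub>v f(v)) |h|\<^sup>2 = |\<omega> \<and> h|\<^sup>2\<close>, and \<open>\<omega> \<and> h\<close> lives on non-simplices. Each of these contains an edge
  \<open>uv\<close>, where \<open>P(u) \<bullet> P(v) \<ge> 1\<close> and where the only two facets that can contribute are those missing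
  \<open>u\<close> or \<open>v\<close>. Hence \<open>|\<omega> \<and> h|\<^sup>2\<close> is at most a sum over all pairs \<open>u, v\<close> with weights
  \<open>P(u) \<bullet> P(v)\<close>; expanding the squares and discarding the cross terms, which form minus a Gram
  matrix, gives \<open>(\<Sum>\<^sub>v f(v)) |h|\<^sup>2 \<le> \<Sum>\<^sub>I D(I) h(I)\<^sup>2\<close> with
  \<open>D(I) = (\<Sum>u\<in>I. P(u)) \<bullet> (\<Sum>\<^sub>v f(v) P(v))\<close>. So a harmonic chain that vanishes on all \<open>I\<close> with
  \<open>D(I) \<ge> \<Sum>\<^sub>v f(v)\<close> is zero, and evaluating the harmonic representative at these \<open>I\<close> separates the
  points of the homology.
\<close>

section \<open>Dimension bounds from separating functionals\<close>

text \<open>Induction on \<open>S\<close>: the kernel of \<open>l s\<close> on \<open>W\<close> is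
  separated by the other functionals, and one vector outside that kernel restores all of
  \<open>W\<close>. Building a generating set yields finite dimensionality at the same time.\<close>

lemma (in vectorspace) submodule_generated_by_separating:
  assumes "finite S" "submodule K W V"
    and l: "\<And>s x. s \<in> S \<Longrightarrow> x \<in> carrier V \<Longrightarrow> l s x \<in> carrier K"
      "\<And>s x y. s \<in> S \<Longrightarrow> x \<in> carrier V \<Longrightarrow> y \<in> carrier V \<Longrightarrow> l s (x \<oplus>\<^bsub>V\<^esub> y) = l s x \<oplus>\<^bsub>K\<^esub> l s y"
      "\<And>s r x. s \<in> S \<Longrightarrow> r \<in> carrier K \<Longrightarrow> x \<in> carrier V \<Longrightarrow> l s (r \<odot>\<^bsub>V\<^esub> x) = r \<otimes>\<^bsub>K\<^esub> l s x"
    and "\<And>x. x \<in> W \<Longrightarrow> (\<And>s. s \<in> S \<Longrightarrow> l s x = \<zero>\<^bsub>K\<^esub>) \<Longrightarrow> x = \<zero>\<^bsub>V\<^esub>"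
  shows "\<exists>G. finite G \<and> card G \<le> card S \<and> G \<subseteq> W \<and> W \<subseteq> span G"
  using assms
proof (induction S arbitrary: W)
  case empty
  then have "W \<subseteq> {\<zero>\<^bsub>V\<^esub>}" by blast
  then show ?case by (intro exI[of _ "{}"]) (simp add: span_empty)
next
  case (insert s S)
  have W: "W \<subseteq> carrier V" "\<zero>\<^bsub>V\<^esub> \<in> W"
    and Wadd: "\<And>x y. x \<in> W \<Longrightarrow> y \<in> W \<Longrightarrow> x \<oplus>\<^bsub>V\<^esub> y \<in> W"
    and Wsm: "\<And>r x. r \<in> carrier K \<Longrightarrow> x \<in> W \<Longrightarrow> r \<odot>\<^bsub>V\<^esub> x \<in> W"
    using insert.prems(1) by (auto simp: LinearCombinations.submodule_def)
  note ls = insert.prems(2-4)[of s, simplified]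
  let ?U = "{x \<in> W. l s x = \<zero>\<^bsub>K\<^esub>}"
  have l0: "l s \<zero>\<^bsub>V\<^esub> = \<zero>\<^bsub>K\<^esub>"
    using ls(3)[of "\<zero>\<^bsub>K\<^esub>" "\<zero>\<^bsub>V\<^esub>"] ls(1)[of "\<zero>\<^bsub>V\<^esub>"] by simp
  have U: "submodule K ?U V"
    unfolding LinearCombinations.submodule_def
    using W Wadd Wsm l0 module.module_axioms by (auto simp: ls subset_iff)
  have "\<exists>G. finite G \<and> card G \<le> card S \<and> G \<subseteq> ?U \<and> ?U \<subseteq> span G"
  proof (rule insert.IH[OF U])
    fix x assume "x \<in> ?U" "\<And>t. t \<in> S \<Longrightarrow> l t x = \<zero>\<^bsub>K\<^esub>"
    then show "x = \<zero>\<^bsub>V\<^esub>" by (intro insert.prems(5)) auto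
  qed (use insert.prems(2-4) in auto)
  then obtain G where G: "finite G" "card G \<le> card S" "G \<subseteq> ?U" "?U \<subseteq> span G" by blast
  show ?case
  proof (cases "?U = W")
    case True
    then show ?thesis using G insert.hyps by (intro exI[of _ G]) auto
  next
    case False
    then obtain w where w: "w \<in> W" "l s w \<noteq> \<zero>\<^bsub>K\<^esub>" by blast
    let ?G = "insert w G"
    have sub: "?G \<subseteq> W" using G w by auto
    then have subV: "?G \<subseteq> carrier V" using W by auto
    have sp: "submodule K (span ?G) V" by (rule span_is_submodule[OF subV])
    have "x \<in> span ?G" if x: "x \<in> W" for x
    proof -
      have xV: "x \<in> carrier V" and wV: "w \<in> carrier V" using x w W by auto
      have lx: "l s x \<in> carrier K" and lw: "l s w \<in> carrier K" using ls(1) xV wV by auto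
      have inv: "inv\<^bsub>K\<^esub> l s w \<in> carrier K" "inv\<^bsub>K\<^esub> l s w \<otimes>\<^bsub>K\<^esub> l s w = \<one>\<^bsub>K\<^esub>"
        using lw w(2) by (simp_all add: field_Units)
      \<comment> \<open>\<open>r\<close> is chosen so that \<open>l s\<close> kills
        \<open>x - r w\<close>; that difference then lies in \<open>?U\<close>, which
        \<open>G\<close> already generates.\<close>
      define r where "r = l s x \<otimes>\<^bsub>K\<^esub> inv\<^bsub>K\<^esub> l s w"
      have r: "r \<in> carrier K" using lx inv by (simp add: r_def)
      have rw: "r \<odot>\<^bsub>V\<^esub> w \<in> carrier V" using r wV by simp
      let ?y = "x \<oplus>\<^bsub>V\<^esub> (\<ominus>\<^bsub>K\<^esub> r) \<odot>\<^bsub>V\<^esub> w"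
      have "l s ?y = l s x \<oplus>\<^bsub>K\<^esub> (\<ominus>\<^bsub>K\<^esub> r) \<otimes>\<^bsub>K\<^esub> l s w"
        using r xV wV by (simp add: ls)
      also have "(\<ominus>\<^bsub>K\<^esub> r) \<otimes>\<^bsub>K\<^esub> l s w = \<ominus>\<^bsub>K\<^esub> (l s x)"
        using lx lw inv r by (simp add: r_def R.l_minus R.m_assoc)
      finally have "l s ?y = \<zero>\<^bsub>K\<^esub>" using lx by (simp add: R.r_neg)
      then have "?y \<in> ?U" using Wadd Wsm x w r by auto
      then have "?y \<in> span ?G" using G(4) span_is_monotone[of G ?G] by blast
      moreover have "r \<odot>\<^bsub>V\<^esub> w \<in> span ?G"
        using in_own_span[OF subV] sp r unfolding LinearCombinations.submodule_def by blast
      ultimately have "?y \<oplus>\<^bsub>V\<^esub> r \<odot>\<^bsub>V\<^esub> w \<in> span ?G"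
        using sp unfolding LinearCombinations.submodule_def by blast
      moreover have "?y \<oplus>\<^bsub>V\<^esub> r \<odot>\<^bsub>V\<^esub> w = x"
        using r xV wV rw by (simp add: smult_l_minus M.a_assoc M.l_neg)
      ultimately show ?thesis by simp
    qed
    moreover have "card ?G \<le> card (insert s S)"
      using G insert.hyps by (simp add: card_insert_if)
    ultimately show ?thesis using G sub by (intro exI[of _ ?G]) auto
  qed
qed

lemma (in vectorspace) dim_le_card_separating:
  assumes "finite S"
    and "\<And>s x. s \<in> S \<Longrightarrow> x \<in> carrier V \<Longrightarrow> l s x \<in> carrier K"
    and "\<And>s x y. s \<in> S \<Longrightarrow> x \<in> carrier V \<Longrightarrow> y \<in> carrier V \<Longrightarrow> l s (x \<oplus>\<^bsub>V\<^esub> y) = l s x \<oplus>\<^bsub>K\<^esub> l s y"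
    and "\<And>s r x. s \<in> S \<Longrightarrow> r \<in> carrier K \<Longrightarrow> x \<in> carrier V \<Longrightarrow> l s (r \<odot>\<^bsub>V\<^esub> x) = r \<otimes>\<^bsub>K\<^esub> l s x"
    and "\<And>x. x \<in> carrier V \<Longrightarrow> (\<And>s. s \<in> S \<Longrightarrow> l s x = \<zero>\<^bsub>K\<^esub>) \<Longrightarrow> x = \<zero>\<^bsub>V\<^esub>"
  shows "dim \<le> card S"
proof -
  have "submodule K (carrier V) V"
    unfolding LinearCombinations.submodule_def using module.module_axioms by auto
  from submodule_generated_by_separating[where l = l, OF assms(1) this assms(2-5)]
  obtain G where G: "finite G" "card G \<le> card S" "G \<subseteq> carrier V" "carrier V \<subseteq> span G"
    by blast
  then have "span G = carrier V" using span_is_subset2 by blast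
  then show ?thesis using gen_ge_dim[OF G(1,3)] G(2) by simp
qed

section \<open>Alternating functions on lists\<close>

definition lists_of :: "'a set \<Rightarrow> nat \<Rightarrow> 'a list set" where
  "lists_of V n = {xs. set xs \<subseteq> V \<and> length xs = n}"

lemma finite_lists_of [simp]: "finite V \<Longrightarrow> finite (lists_of V n)"
  by (simp add: lists_of_def finite_lists_length_eq)

lemma sum_lists_of_Suc:
  "(\<Sum>xs\<in>lists_of V (Suc n). \<phi> xs) = (\<Sum>v\<in>V. \<Sum>ys\<in>lists_of V n. \<phi> (v # ys))"
  unfolding sum.cartesian_product
  by (rule sum.reindex_bij_witness[of _ "\<lambda>(v, ys). v # ys" "\<lambda>xs. (hd xs, tl xs)"])
    (auto simp: lists_of_def length_Suc_conv)

lemma sum_lists_of_permute: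
  assumes p: "p permutes {..<n}"
  shows "(\<Sum>xs\<in>lists_of V n. \<phi> (permute_list p xs)) = (\<Sum>xs\<in>lists_of V n. \<phi> xs)"
proof -
  have inv: "inv_into UNIV p permutes {..<n}" using p by (rule permutes_inv)
  have mem: "permute_list q xs \<in> lists_of V n"
    if "q permutes {..<n}" "xs \<in> lists_of V n" for q xs
    using that by (auto simp: lists_of_def)
  have 1: "permute_list p (permute_list (inv_into UNIV p) xs) = xs" if "xs \<in> lists_of V n" for xs
    using permute_list_compose[of p xs "inv_into UNIV p"] inv p that
    by (simp add: lists_of_def permutes_inv_o)
  have 2: "permute_list (inv_into UNIV p) (permute_list p xs) = xs" if "xs \<in> lists_of V n" for xs
    using permute_list_compose[of "inv_into UNIV p" xs p] inv p that
    by (simp add: lists_of_def permutes_inv_o)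
  show ?thesis
    by (rule sum.reindex_bij_witness[of _ "permute_list (inv_into UNIV p)" "permute_list p"])
      (simp_all add: 1 2 mem[OF p] mem[OF inv])
qed

lemma transpose_permutes_lessThan: "i < n \<Longrightarrow> j < n \<Longrightarrow> Transposition.transpose i j permutes {..<n}"
  by (rule permutes_swap_id) auto

lemma permutation_of_pair:
  assumes "i < n" "j < n" "i \<noteq> j" "1 < (n::nat)"
  obtains p where "p permutes {..<n}" "p 0 = i" "p 1 = j"
proof -
  let ?s = "Transposition.transpose 0 i"
  let ?p = "?s \<circ> Transposition.transpose 1 (?s j)"
  have "?s j \<noteq> 0" "?s j < n" using assms by (auto simp: Transposition.transpose_def)
  then have "?p permutes {..<n}"
    using assms by (intro permutes_compose transpose_permutes_lessThan) auto
  moreover have "?p 0 = i" "?p 1 = j"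
    using \<open>?s j \<noteq> 0\<close> by simp_all
  ultimately show ?thesis by (rule that)
qed

text \<open>The sign rule of \<open>oriented_chains\<close> without its support condition: the wedge
  product of a chain is alternating but may leave the complex.\<close>

definition alternating :: "('a list \<Rightarrow> real) \<Rightarrow> bool" where
  "alternating c \<longleftrightarrow>
     (\<forall>xs p. p permutes {..<length xs} \<longrightarrow> c (permute_list p xs) = of_int (sign p) * c xs)"

lemma alternatingD:
  "alternating c \<Longrightarrow> p permutes {..<length xs} \<Longrightarrow> c (permute_list p xs) = of_int (sign p) * c xs"
  by (simp add: alternating_def)

text \<open>Exchanging two equal entries fixes the list but has sign -1, so the value equals its own
  negative.\<close>

lemma alternating_not_distinct:
  assumes c: "alternating c" and nd: "\<not> distinct xs"
  shows "c xs = 0"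
proof -
  obtain i j where ij: "i < length xs" "j < length xs" "i \<noteq> j" "xs ! i = xs ! j"
    using nd by (auto simp: distinct_conv_nth)
  let ?t = "Transposition.transpose i j"
  have t: "?t permutes {..<length xs}" using ij by (intro transpose_permutes_lessThan)
  have "permute_list ?t xs = xs"
    by (rule nth_equalityI)
      (use t ij in \<open>auto simp: permute_list_nth Transposition.transpose_def\<close>)
  then show ?thesis using alternatingD[OF c t] ij by (simp add: sign_swap_id)
qed

text \<open>A converse to \<open>permute_list_Cons\<close>: a \<open>q\<close> fixing 0 permutes the
  positive indices, and shifting these by 1 gives a permutation of the tail with the same
  sign.\<close>

lemma permute_list_Cons_fixing_head:
  assumes q: "q permutes {..<Suc (length ys)}" and q0: "q 0 = 0"
  obtains p where "p permutes {..<length ys}" "sign p = sign q"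
    "permute_list q (v # ys) = v # permute_list p ys"
proof -
  let ?n = "length ys"
  let ?A = "Suc ` {..<?n}"
  let ?p = "map_permutation ?A (\<lambda>i. i - 1) q"
  have qA: "q permutes ?A"
    by (rule permutes_superset[OF q]) (use q0 in \<open>auto simp: image_iff less_Suc_eq_0_disj\<close>)
  have bij: "bij_betw (\<lambda>i. i - 1) ?A {..<?n}"
    by (rule bij_betwI[of _ _ _ Suc]) auto
  have p: "?p permutes {..<?n}" by (rule map_permutation_permutes[OF bij qA])
  moreover have "sign ?p = sign q"
    by (rule sign_map_permutation[OF bij_betw_imp_inj_on[OF bij] qA]) simp
  moreover have "permute_list q (v # ys) = v # permute_list ?p ys"
  proof (rule nth_equalityI)
    fix i assume i: "i < length (permute_list q (v # ys))"
    show "permute_list q (v # ys) ! i = (v # permute_list ?p ys) ! i"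
    proof (cases i)
      case 0
      then show ?thesis using q q0 by (simp add: permute_list_nth)
    next
      case (Suc j)
      then have j: "j < ?n" using i by simp
      then have "q (Suc j) \<in> ?A" using permutes_in_image[OF qA] by blast
      moreover have "?p j = q (Suc j) - 1"
        using map_permutation_apply[OF bij_betw_imp_inj_on[OF bij], of "Suc j" q] j by auto
      ultimately show ?thesis using Suc j q p by (auto simp: permute_list_nth)
    qed
  qed simp
  ultimately show ?thesis by (rule that)
qed

text \<open>The signed sum below is the wedge product with \<open>\<Sum>\<^sub>v f(v) e\<^sub>v\<close>: for an alternating \<open>h\<close> the
  summands depend only on which entry is moved to the front, so transpositions serve as
  representatives.\<close>

definition weighted_cone :: "('a \<Rightarrow> real) \<Rightarrow> ('a list \<Rightarrow> real) \<Rightarrow> 'a list \<Rightarrow> real" where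
  "weighted_cone f h xs = f (hd xs) * h (tl xs)"

definition wedge :: "('a \<Rightarrow> real) \<Rightarrow> ('a list \<Rightarrow> real) \<Rightarrow> 'a list \<Rightarrow> real" where
  "wedge f h xs = (\<Sum>i<length xs. of_int (sign (Transposition.transpose 0 i)) *
     weighted_cone f h (permute_list (Transposition.transpose 0 i) xs))"

text \<open>Here \<open>p' = p \<circ> ?q\<close> with \<open>?q\<close> fixing 0, so both lists
  have the same head and their tails differ by a permutation of sign \<open>sign ?q\<close>.
  Alternation of \<open>h\<close> compensates that sign.\<close>

lemma signed_cone_cong:
  assumes h: "alternating h" and xs: "xs \<noteq> []"
    and p: "p permutes {..<length xs}" and p': "p' permutes {..<length xs}" and eq: "p 0 = p' 0"
  shows "of_int (sign p) * weighted_cone f h (permute_list p xs) =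
    of_int (sign p') * weighted_cone f h (permute_list p' xs)"
proof -
  let ?q = "inv_into UNIV p \<circ> p'"
  have q: "?q permutes {..<length xs}" using p p' by (intro permutes_compose permutes_inv)
  have perm: "permutation p" "permutation ?q" "permutation p'"
    using p q p' by (auto intro: permutation_permutes[THEN iffD2])
  have pq: "p' = p \<circ> ?q" by (simp add: fun_eq_iff permutes_inverses(1)[OF p])
  have q0: "?q 0 = 0" by (simp add: eq[symmetric] permutes_inverses(2)[OF p])
  obtain y ys where y: "permute_list p xs = y # ys"
    using xs by (metis length_permute_list length_0_conv neq_Nil_conv)
  have len: "length xs = Suc (length ys)" using arg_cong[OF y, of length] by simp
  obtain r where r: "r permutes {..<length ys}" "sign r = sign ?q"
    "permute_list ?q (y # ys) = y # permute_list r ys"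
    using permute_list_Cons_fixing_head[OF q[unfolded len] q0] by blast
  have "permute_list p' xs = permute_list ?q (permute_list p xs)"
    using permute_list_compose[OF q, of p] pq by simp
  then have "permute_list p' xs = y # permute_list r ys" using r y by simp
  moreover have "sign p' = sign p * sign ?q"
    using sign_compose[OF perm(1,2)] pq by simp
  moreover have "of_int (sign ?q) * (of_int (sign ?q) :: real) = 1"
    by (metis of_int_1 of_int_mult sign_idempotent)
  ultimately show ?thesis
    using y alternatingD[OF h r(1)] r(2) by (simp add: weighted_cone_def)
qed

text \<open>Since \<open>p \<circ> transpose 0 i\<close> and \<open>transpose 0 (p i)\<close> agree
  at 0, permuting the argument by \<open>p\<close> turns summand \<open>i\<close> into
  \<open>sign p\<close> times summand \<open>p i\<close>.\<close>

lemma alternating_wedge: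
  assumes h: "alternating h"
  shows "alternating (wedge f h)"
  unfolding alternating_def
proof (intro allI impI)
  fix xs :: "'a list" and p :: "nat \<Rightarrow> nat" assume p: "p permutes {..<length xs}"
  let ?t = "Transposition.transpose (0::nat)"
  let ?F = "\<lambda>i. of_int (sign (?t i)) * weighted_cone f h (permute_list (?t i) xs)"
  have "of_int (sign (?t i)) * weighted_cone f h (permute_list (?t i) (permute_list p xs)) =
      of_int (sign p) * ?F (p i)" if i: "i < length xs" for i
  proof -
    have t: "?t i permutes {..<length xs}" using i by (intro transpose_permutes_lessThan) auto
    have pi: "p i < length xs" using permutes_in_image[OF p] i by auto
    have t': "?t (p i) permutes {..<length xs}"
      using pi by (intro transpose_permutes_lessThan) auto
    have "permutation p" "permutation (?t i)"
      using p t by (auto intro: permutation_permutes[THEN iffD2])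
    then have s: "sign (p \<circ> ?t i) = sign p * sign (?t i)" by (rule sign_compose)
    have "?F (p i) = of_int (sign (p \<circ> ?t i)) * weighted_cone f h (permute_list (p \<circ> ?t i) xs)"
      by (rule signed_cone_cong[OF h _ t' permutes_compose[OF t p]]) (use i in auto)
    then have "of_int (sign p) * ?F (p i) = of_int (sign p * sign p) * of_int (sign (?t i)) *
        weighted_cone f h (permute_list (p \<circ> ?t i) xs)" by (simp add: s del: sign_idempotent)
    then show ?thesis using t by (simp add: permute_list_compose)
  qed
  then have "wedge f h (permute_list p xs) = (\<Sum>i<length xs. of_int (sign p) * ?F (p i))"
    by (simp add: wedge_def)
  also have "\<dots> = of_int (sign p) * (\<Sum>i<length xs. ?F (p i))" by (simp add: sum_distrib_left)
  also have "(\<Sum>i<length xs. ?F (p i)) = wedge f h xs"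
    unfolding wedge_def using sum.permute[OF p, of ?F] by (simp add: comp_def)
  finally show "wedge f h (permute_list p xs) = of_int (sign p) * wedge f h xs" .
qed

text \<open>Index 0 gives the identity. Every other transposition puts \<open>x\<close> into the
  slot vacated by \<open>ys ! b\<close>, and its sign -1 gives the subtraction.\<close>

lemma wedge_Cons:
  "wedge f h (x # ys) = f x * h ys - (\<Sum>b<length ys. f (ys ! b) * h (ys[b := x]))"
proof -
  have "permute_list (Transposition.transpose 0 (Suc b)) (x # ys) = ys ! b # ys[b := x]"
    if b: "b < length ys" for b
  proof (rule nth_equalityI)
    have t: "Transposition.transpose 0 (Suc b) permutes {..<length (x # ys)}"
      using b by (intro transpose_permutes_lessThan) auto
    fix i assume "i < length (permute_list (Transposition.transpose 0 (Suc b)) (x # ys))"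
    then show "permute_list (Transposition.transpose 0 (Suc b)) (x # ys) ! i
        = (ys ! b # ys[b := x]) ! i"
      using t b by (cases i) (auto simp: permute_list_nth Transposition.transpose_def)
  qed simp
  then have "(\<Sum>b<length ys. of_int (sign (Transposition.transpose 0 (Suc b))) *
      weighted_cone f h (permute_list (Transposition.transpose 0 (Suc b)) (x # ys)))
      = (\<Sum>b<length ys. - (f (ys ! b) * h (ys[b := x])))"
    by (intro sum.cong) (auto simp: sign_swap_id weighted_cone_def)
  then show ?thesis
    unfolding wedge_def length_Cons sum.lessThan_Suc_shift by (simp add: sum_negf weighted_cone_def)
qed

text \<open>The cycle condition concerns the first slot; a transposition moves slot \<open>b\<close>
  there at the cost of a common sign.\<close>

lemma sum_slot_eq_0:
  assumes h: "alternating h" and cyc: "\<And>zs. (\<Sum>v\<in>V. h (v # zs)) = 0" and b: "b < length ys"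
  shows "(\<Sum>x\<in>V. h (ys[b := x])) = 0"
proof -
  let ?t = "Transposition.transpose 0 b"
  let ?zs = "tl (permute_list ?t ys)"
  have t: "?t permutes {..<length ys}" using b by (intro transpose_permutes_lessThan) auto
  have "permute_list ?t (ys[b := x]) = x # ?zs" for x
  proof (rule nth_equalityI)
    fix i assume i: "i < length (permute_list ?t (ys[b := x]))"
    show "permute_list ?t (ys[b := x]) ! i = (x # ?zs) ! i"
    proof (cases i)
      case 0
      moreover have "0 < length ys" using b by linarith
      ultimately show ?thesis using t b permute_list_nth[of ?t "ys[b := x]" 0] by simp
    next
      case (Suc j)
      then have "?t i \<noteq> b" by (auto simp: Transposition.transpose_def)
      then show ?thesis using Suc t i by (simp add: permute_list_nth nth_tl)
    qed
  qed (use b in simp)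
  then have "h (ys[b := x]) = of_int (sign ?t) * h (x # ?zs)" for x
    using alternatingD[OF h, of ?t "ys[b := x]"] t
    by (simp add: sign_swap_id split: if_splits)
  then show ?thesis using cyc by (simp add: sum_distrib_left[symmetric])
qed

text \<open>The identity for \<open>\<iota>(\<omega> \<and> h) + \<omega> \<and> \<iota>h\<close>
  with \<open>\<iota>h = 0\<close>, where \<open>\<iota>\<close> sums over the first entry. In
  \<open>wedge_Cons\<close> the leading terms give the right-hand side, and all slot sums
  vanish.\<close>

lemma sum_wedge_Cons:
  assumes h: "alternating h" and cyc: "\<And>zs. (\<Sum>v\<in>V. h (v # zs)) = 0"
  shows "(\<Sum>x\<in>V. wedge f h (x # ys)) = (\<Sum>x\<in>V. f x) * h ys"
proof -
  have "(\<Sum>x\<in>V. \<Sum>b<length ys. f (ys ! b) * h (ys[b := x]))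
      = (\<Sum>b<length ys. f (ys ! b) * (\<Sum>x\<in>V. h (ys[b := x])))"
    by (subst sum.swap) (simp add: sum_distrib_left)
  also have "\<dots> = 0" using sum_slot_eq_0[OF h cyc] by simp
  finally show ?thesis by (simp add: wedge_Cons sum_subtractf sum_distrib_right)
qed

section \<open>The weighted inner product and the adjoint of the boundary\<close>

locale weighted_vertices =
  fixes V :: "'a set" and f :: "'a \<Rightarrow> real"
  assumes finite_V: "finite V" and f_pos: "\<And>v. v \<in> V \<Longrightarrow> f v > 0"
begin

text \<open>Weighting by \<open>1 / f\<close> avoids the square roots of the rescaled picture, and summing over
  ordered simplices counts each simplex once per ordering.\<close>

definition wt :: "'a list \<Rightarrow> real" where
  "wt xs = prod_list (map (\<lambda>x. 1 / f x) xs)"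

definition ip :: "nat \<Rightarrow> ('a list \<Rightarrow> real) \<Rightarrow> ('a list \<Rightarrow> real) \<Rightarrow> real" where
  "ip n c d = (\<Sum>xs\<in>lists_of V n. wt xs * c xs * d xs)"

lemma wt_Cons [simp]: "wt (x # xs) = wt xs / f x"
  by (simp add: wt_def)

lemma wt_permute: "p permutes {..<length xs} \<Longrightarrow> wt (permute_list p xs) = wt xs"
  unfolding wt_def prod_mset_prod_list[symmetric] mset_map by simp

lemma wt_pos: "set xs \<subseteq> V \<Longrightarrow> wt xs > 0"
  by (induction xs) (auto simp: wt_def f_pos)

lemma ip_commute: "ip n c d = ip n d c"
  by (simp add: ip_def mult_ac)

text \<open>All \<open>Suc n\<close> summands of the wedge contribute equally: reindexing the lists
  by the transposition preserves \<open>wt\<close>, and the alternating \<open>c\<close> absorbs the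
  sign.\<close>

lemma ip_wedge:
  assumes c: "alternating c"
  shows "ip (Suc n) c (wedge f h) = Suc n * ip (Suc n) c (weighted_cone f h)"
proof -
  let ?t = "Transposition.transpose (0::nat)"
  let ?L = "lists_of V (Suc n)"
  have "ip (Suc n) c (wedge f h) = (\<Sum>xs\<in>?L. \<Sum>i<Suc n. of_int (sign (?t i)) * wt xs * c xs *
      weighted_cone f h (permute_list (?t i) xs))"
    unfolding ip_def wedge_def sum_distrib_left
    by (intro sum.cong) (auto simp: lists_of_def mult_ac)
  also have "\<dots> = (\<Sum>i<Suc n. \<Sum>xs\<in>?L. of_int (sign (?t i)) * wt xs * c xs *
      weighted_cone f h (permute_list (?t i) xs))"
    by (rule sum.swap)
  also have "\<dots> = (\<Sum>i<Suc n. ip (Suc n) c (weighted_cone f h))"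
  proof (rule sum.cong[OF refl])
    fix i assume "i \<in> {..<Suc n}"
    then have t: "?t i permutes {..<Suc n}" by (intro transpose_permutes_lessThan) auto
    have "(\<Sum>xs\<in>?L. of_int (sign (?t i)) * wt xs * c xs * weighted_cone f h (permute_list (?t i) xs))
        = (\<Sum>xs\<in>?L. wt (permute_list (?t i) xs) * c (permute_list (?t i) xs) *
            weighted_cone f h (permute_list (?t i) xs))"
      by (rule sum.cong) (use t in \<open>auto simp: lists_of_def wt_permute alternatingD[OF c]\<close>)
    also have "\<dots> = ip (Suc n) c (weighted_cone f h)"
      unfolding ip_def by (rule sum_lists_of_permute[OF t])
    finally show "(\<Sum>xs\<in>?L. of_int (sign (?t i)) * wt xs * c xs *
        weighted_cone f h (permute_list (?t i) xs)) = ip (Suc n) c (weighted_cone f h)" .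
  qed
  finally show ?thesis by simp
qed

text \<open>Adjointness of cone and contraction: the factor \<open>f v\<close> of the cone cancels
  the factor \<open>1 / f v\<close> in the weight of \<open>v # ys\<close>.\<close>

lemma ip_cone: "ip (Suc n) c (weighted_cone f h) = ip n (\<lambda>ys. \<Sum>v\<in>V. c (v # ys)) h"
proof -
  have "ip (Suc n) c (weighted_cone f h) = (\<Sum>v\<in>V. \<Sum>ys\<in>lists_of V n. wt ys * c (v # ys) * h ys)"
    unfolding ip_def sum_lists_of_Suc
    by (intro sum.cong) (auto simp: weighted_cone_def dest: f_pos)
  also have "\<dots> = (\<Sum>ys\<in>lists_of V n. \<Sum>v\<in>V. wt ys * c (v # ys) * h ys)"
    by (rule sum.swap)
  finally show ?thesis by (simp add: ip_def sum_distrib_left sum_distrib_right)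
qed

text \<open>Moving one wedge across the inner product leaves the contraction of
  \<open>wedge f h\<close> paired with \<open>h\<close>. The factor \<open>Suc n\<close> reflects
  that a set of size n+1 has n+1 times as many orderings as one of size n.\<close>

lemma ip_wedge_wedge:
  assumes h: "alternating h" and cyc: "\<And>zs. (\<Sum>v\<in>V. h (v # zs)) = 0"
  shows "ip (Suc n) (wedge f h) (wedge f h) = Suc n * ((\<Sum>v\<in>V. f v) * ip n h h)"
proof -
  have "ip (Suc n) (wedge f h) (wedge f h) = Suc n * ip n (\<lambda>ys. (\<Sum>v\<in>V. f v) * h ys) h"
    using h by (simp add: ip_wedge alternating_wedge ip_cone sum_wedge_Cons[OF h cyc])
  also have "ip n (\<lambda>ys. (\<Sum>v\<in>V. f v) * h ys) h = (\<Sum>v\<in>V. f v) * ip n h h"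
    unfolding ip_def sum_distrib_left[of "\<Sum>v\<in>V. f v"] by (simp add: mult_ac)
  finally show ?thesis .
qed

lemma ip_self_eq_0:
  assumes "ip n c c = 0" "set xs \<subseteq> V" "length xs = n"
  shows "c xs = 0"
proof -
  have nn: "0 \<le> wt ys * c ys * c ys" if "ys \<in> lists_of V n" for ys
    using wt_pos[of ys] that by (simp add: lists_of_def mult.assoc)
  have "wt xs * c xs * c xs = 0"
    using assms sum_nonneg_eq_0_iff[OF finite_lists_of[OF finite_V] nn]
    unfolding ip_def by (auto simp: lists_of_def)
  then show ?thesis using wt_pos[OF assms(2)] by simp
qed

end

section \<open>The inequality for harmonic chains\<close>

locale weighted_representation = weighted_vertices V f for V :: "'a set" and f +
  fixes E :: "'a set set" and P :: "'a \<Rightarrow> 'b :: real_inner"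
  assumes card_edge: "\<And>e. e \<in> E \<Longrightarrow> card e = 2"
    and inner_nonneg: "\<And>u v. u \<in> V \<Longrightarrow> v \<in> V \<Longrightarrow> 0 \<le> inner (P u) (P v)"
    and inner_edge: "\<And>u v. u \<in> V \<Longrightarrow> v \<in> V \<Longrightarrow> {u, v} \<in> E \<Longrightarrow> 1 \<le> inner (P u) (P v)"
begin

text \<open>The quantity \<open>D(I)\<close> of the overview is the sum of \<open>load\<close> over
  \<open>I\<close>.\<close>

definition load :: "'a \<Rightarrow> real" where
  "load u = inner (P u) (\<Sum>v\<in>V. f v *\<^sub>R P v)"

definition adj :: "'a \<Rightarrow> 'a \<Rightarrow> real" where
  "adj u v = (if {u, v} \<in> E then 1 else 0)"

lemma adj_nonneg: "0 \<le> adj u v"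
  by (simp add: adj_def)

lemma adj_self [simp]: "adj u u = 0"
  using card_edge[of "{u}"] by (auto simp: adj_def)

lemma adj_le_inner: "u \<in> V \<Longrightarrow> v \<in> V \<Longrightarrow> adj u v \<le> inner (P u) (P v)"
  by (simp add: adj_def inner_nonneg inner_edge)

text \<open>Squaring removes the sign of a permutation, so all pairs of distinct positions are
  equivalent. The first two entries are the pair that \<open>wedge_at_edge\<close> can
  evaluate.\<close>

lemma sum_pairs_eq:
  assumes c: "alternating c" and ij: "i < Suc n" "j < Suc n" "i \<noteq> j"
  shows "(\<Sum>xs\<in>lists_of V (Suc n). wt xs * (c xs)\<^sup>2 * adj (xs ! i) (xs ! j)) =
    (\<Sum>xs\<in>lists_of V (Suc n). wt xs * (c xs)\<^sup>2 * adj (xs ! 0) (xs ! 1))"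
proof -
  have n: "1 < Suc n" using ij by linarith
  obtain p where p: "p permutes {..<Suc n}" "p 0 = i" "p 1 = j"
    using permutation_of_pair[OF ij n] by blast
  have sq: "(of_int (sign p) * x)\<^sup>2 = x\<^sup>2" for x :: real
    by (cases p rule: sign_cases) auto
  show ?thesis
    unfolding sum_lists_of_permute[OF p(1), symmetric,
        of "\<lambda>xs. wt xs * (c xs)\<^sup>2 * adj (xs ! 0) (xs ! 1)" V]
  proof (rule sum.cong[OF refl])
    fix xs assume "xs \<in> lists_of V (Suc n)"
    then have len: "length xs = Suc n" by (simp add: lists_of_def)
    then have q: "p permutes {..<length xs}" using p by simp
    have "permute_list p xs ! 0 = xs ! i" "permute_list p xs ! 1 = xs ! j"
      using permute_list_nth[OF q] len n p by auto
    then show "wt xs * (c xs)\<^sup>2 * adj (xs ! i) (xs ! j) = wt (permute_list p xs) *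
        (c (permute_list p xs))\<^sup>2 * adj (permute_list p xs ! 0) (permute_list p xs ! 1)"
      using q by (simp add: wt_permute alternatingD[OF c] sq)
  qed
qed

text \<open>By symmetry each position contributes as the first one does. Sums over
  \<open>set xs\<close> and over positions can differ only at lists with repetitions, where
  \<open>c\<close> vanishes.\<close>

lemma sum_load_eq:
  assumes c: "alternating c"
  shows "(\<Sum>xs\<in>lists_of V n. wt xs * (c xs)\<^sup>2 * (\<Sum>u\<in>set xs. load u)) =
    n * (\<Sum>xs\<in>lists_of V n. wt xs * (c xs)\<^sup>2 * load (xs ! 0))"
proof -
  have "(\<Sum>xs\<in>lists_of V n. wt xs * (c xs)\<^sup>2 * (\<Sum>u\<in>set xs. load u)) =
      (\<Sum>xs\<in>lists_of V n. \<Sum>i<n. wt xs * (c xs)\<^sup>2 * load (xs ! i))"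
  proof (rule sum.cong[OF refl])
    fix xs assume "xs \<in> lists_of V n"
    then have len: "length xs = n" by (simp add: lists_of_def)
    show "wt xs * (c xs)\<^sup>2 * (\<Sum>u\<in>set xs. load u) = (\<Sum>i<n. wt xs * (c xs)\<^sup>2 * load (xs ! i))"
    proof (cases "distinct xs")
      case True
      have "(\<Sum>u\<in>set xs. load u) = (\<Sum>i<n. load (xs ! i))"
        by (rule sum.reindex_bij_betw[OF bij_betw_nth, symmetric]) (use True len in auto)
      then show ?thesis by (simp add: sum_distrib_left)
    qed (simp add: alternating_not_distinct[OF c])
  qed
  also have "\<dots> = (\<Sum>i<n. \<Sum>xs\<in>lists_of V n. wt xs * (c xs)\<^sup>2 * load (xs ! i))"
    by (rule sum.swap)
  also have "\<dots> = (\<Sum>i<n. \<Sum>xs\<in>lists_of V n. wt xs * (c xs)\<^sup>2 * load (xs ! 0))"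
  proof (rule sum.cong[OF refl])
    fix i assume i: "i \<in> {..<n}"
    let ?t = "Transposition.transpose 0 i"
    have t: "?t permutes {..<n}" using i by (intro transpose_permutes_lessThan) auto
    have sq: "(of_int (sign ?t) * x)\<^sup>2 = x\<^sup>2" for x :: real
      by (cases ?t rule: sign_cases) auto
    show "(\<Sum>xs\<in>lists_of V n. wt xs * (c xs)\<^sup>2 * load (xs ! i)) =
        (\<Sum>xs\<in>lists_of V n. wt xs * (c xs)\<^sup>2 * load (xs ! 0))"
      unfolding sum_lists_of_permute[OF t, symmetric, of "\<lambda>xs. wt xs * (c xs)\<^sup>2 * load (xs ! 0)" V]
      by (rule sum.cong)
        (use t i in \<open>auto simp: lists_of_def wt_permute alternatingD[OF c] sq permute_list_nth\<close>)
  qed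
  finally show ?thesis by simp
qed

text \<open>The square divided by \<open>f u * f v\<close> is
  \<open>f u * (x v)^2 / f v + f v * (x u)^2 / f u - 2 * x u * x v\<close>. The first two parts each
  sum to half of the right-hand side, the last to minus twice the squared norm of the sum of the
  \<open>x u *\<^sub>R P u\<close>.\<close>

lemma sum_inner_square_le:
  "(\<Sum>u\<in>V. \<Sum>v\<in>V. 1 / (f u * f v) * inner (P u) (P v) * (f u * x v - f v * x u)\<^sup>2)
    \<le> 2 * (\<Sum>u\<in>V. x u ^ 2 / f u * load u)"
proof -
  let ?a = "\<lambda>u v. inner (P u) (P v)"
  have eq: "1 / (f u * f v) * ?a u v * (f u * x v - f v * x u)\<^sup>2 =
      (x v)\<^sup>2 / f v * (f u * ?a v u) + (x u)\<^sup>2 / f u * (f v * ?a u v)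
       - 2 * inner (x u *\<^sub>R P u) (x v *\<^sub>R P v)"
    if "u \<in> V" "v \<in> V" for u v
    using f_pos[OF that(1)] f_pos[OF that(2)]
    by (simp add: field_simps power2_eq_square inner_commute[of "P v"])
  have load: "load u = (\<Sum>v\<in>V. f v * ?a u v)" for u
    by (simp add: load_def inner_sum_right)
  have "(\<Sum>u\<in>V. \<Sum>v\<in>V. 1 / (f u * f v) * ?a u v * (f u * x v - f v * x u)\<^sup>2) =
      (\<Sum>u\<in>V. \<Sum>v\<in>V. (x v)\<^sup>2 / f v * (f u * ?a v u) + (x u)\<^sup>2 / f u * (f v * ?a u v)
       - 2 * inner (x u *\<^sub>R P u) (x v *\<^sub>R P v))"
    by (intro sum.cong refl eq)
  also have "\<dots> = (\<Sum>u\<in>V. \<Sum>v\<in>V. (x v)\<^sup>2 / f v * (f u * ?a v u))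
      + (\<Sum>u\<in>V. \<Sum>v\<in>V. (x u)\<^sup>2 / f u * (f v * ?a u v))
      - 2 * inner (\<Sum>u\<in>V. x u *\<^sub>R P u) (\<Sum>v\<in>V. x v *\<^sub>R P v)"
    unfolding inner_sum_left
    by (simp only: inner_sum_right sum_subtractf sum.distrib sum_distrib_left)
  also have "(\<Sum>u\<in>V. \<Sum>v\<in>V. (x v)\<^sup>2 / f v * (f u * ?a v u)) = (\<Sum>u\<in>V. x u ^ 2 / f u * load u)"
    by (subst sum.swap) (simp add: load sum_distrib_left)
  also have "(\<Sum>u\<in>V. \<Sum>v\<in>V. (x u)\<^sup>2 / f u * (f v * ?a u v)) = (\<Sum>u\<in>V. x u ^ 2 / f u * load u)"
    by (simp add: load sum_distrib_left)
  finally show ?thesis by simp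
qed

text \<open>Deleting an entry of \<open>\<rho>\<close> leaves both \<open>u\<close> and
  \<open>v\<close>, so \<open>h\<close> vanishes on that facet; only the facets missing
  \<open>u\<close> or \<open>v\<close> survive.\<close>

lemma wedge_at_edge:
  assumes supp: "\<And>xs. h xs \<noteq> 0 \<Longrightarrow> set xs \<in> independence_complex V E" and e: "{u, v} \<in> E"
  shows "wedge f h (u # v # \<rho>) = f u * h (v # \<rho>) - f v * h (u # \<rho>)"
proof -
  have "h (v # \<rho>[b := u]) = 0" if "b < length \<rho>" for b
  proof (rule ccontr)
    assume "h (v # \<rho>[b := u]) \<noteq> 0"
    then have "set (v # \<rho>[b := u]) \<in> independence_complex V E" by (rule supp)
    moreover have "u \<in> set (\<rho>[b := u])" using that by (rule set_update_memI)
    ultimately show False using e by (auto simp: independence_complex_def)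
  qed
  then show ?thesis unfolding wedge_Cons length_Cons sum.lessThan_Suc_shift by simp
qed

lemma harmonic_inequality:
  assumes h: "alternating h" and cyc: "\<And>zs. (\<Sum>v\<in>V. h (v # zs)) = 0"
    and supp: "\<And>xs. h xs \<noteq> 0 \<Longrightarrow> set xs \<in> independence_complex V E"
    and cocyc: "\<And>xs. xs \<in> lists_of V (Suc n) \<Longrightarrow> set xs \<in> independence_complex V E \<Longrightarrow>
      wedge f h xs = 0"
    and n: "n > 0"
  shows "(\<Sum>v\<in>V. f v) * ip n h h \<le>
    (\<Sum>xs\<in>lists_of V n. wt xs * (h xs)\<^sup>2 * (\<Sum>u\<in>set xs. load u))"
proof -
  obtain m where m: "n = Suc m" using n gr0_implies_Suc by blast
  let ?W = "wedge f h"
  let ?L = "lists_of V (Suc n)"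
  let ?T = "\<Sum>xs\<in>?L. wt xs * (?W xs)\<^sup>2 * adj (xs ! 0) (xs ! 1)"
  let ?D = "\<Sum>xs\<in>lists_of V n. wt xs * (h xs)\<^sup>2 * load (xs ! 0)"
  have W: "alternating ?W" by (rule alternating_wedge[OF h])
  \<comment> \<open>An edge inside \<open>xs\<close> is counted at both \<open>(i, j)\<close> and
    \<open>(j, i)\<close>, hence the factor 2. Without an edge \<open>xs\<close> spans a simplex,
    where the wedge vanishes by \<open>cocyc\<close>.\<close>
  have "2 * (wt xs * ?W xs * ?W xs) \<le>
      (\<Sum>i<Suc n. \<Sum>j<Suc n. wt xs * (?W xs)\<^sup>2 * adj (xs ! i) (xs ! j))"
    if xs: "xs \<in> ?L" for xs
  proof -
    have len: "length xs = Suc n" and sub: "set xs \<subseteq> V" using xs by (auto simp: lists_of_def)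
    have "2 \<le> (\<Sum>i<Suc n. \<Sum>j<Suc n. adj (xs ! i) (xs ! j))" if nz: "?W xs \<noteq> 0"
    proof -
      have "set xs \<notin> independence_complex V E" using cocyc[OF xs] nz by blast
      then obtain i j where ij: "i < Suc n" "j < Suc n" "{xs ! i, xs ! j} \<in> E"
        using sub len by (auto simp: independence_complex_def in_set_conv_nth)
      then have ne: "i \<noteq> j" using card_edge[of "{xs ! i, xs ! j}"] by auto
      have "2 = adj (xs ! i) (xs ! j) + adj (xs ! j) (xs ! i)"
        using ij by (simp add: adj_def insert_commute)
      also have "\<dots> = (\<Sum>(i, j)\<in>{(i, j), (j, i)}. adj (xs ! i) (xs ! j))" using ne by simp
      also have "\<dots> \<le> (\<Sum>(i, j)\<in>{..<Suc n} \<times> {..<Suc n}. adj (xs ! i) (xs ! j))"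
        by (rule sum_mono2) (use ij adj_nonneg in auto)
      finally show ?thesis by (simp only: sum.cartesian_product)
    qed
    then have "?W xs = 0 \<or> wt xs * (?W xs)\<^sup>2 * 2 \<le>
        wt xs * (?W xs)\<^sup>2 * (\<Sum>i<Suc n. \<Sum>j<Suc n. adj (xs ! i) (xs ! j))"
      using wt_pos[OF sub] by (auto intro!: mult_left_mono simp del: sum.lessThan_Suc)
    then show ?thesis
      by (auto simp: sum_distrib_left power2_eq_square mult_ac simp del: sum.lessThan_Suc)
  qed
  then have "2 * ip (Suc n) ?W ?W \<le>
      (\<Sum>xs\<in>?L. \<Sum>i<Suc n. \<Sum>j<Suc n. wt xs * (?W xs)\<^sup>2 * adj (xs ! i) (xs ! j))"
    unfolding ip_def sum_distrib_left by (intro sum_mono)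
  also have "\<dots> = (\<Sum>i<Suc n. \<Sum>j<Suc n. \<Sum>xs\<in>?L. wt xs * (?W xs)\<^sup>2 * adj (xs ! i) (xs ! j))"
    by (subst sum.swap) (rule sum.cong[OF refl], rule sum.swap)
  \<comment> \<open>No edge joins a vertex to itself, so the diagonal vanishes; all other terms
    equal \<open>?T\<close> by symmetry.\<close>
  also have "\<dots> = (\<Sum>i<Suc n. \<Sum>j<Suc n. if i = j then 0 else ?T)"
  proof (intro sum.cong[OF refl])
    fix i j assume "i \<in> {..<Suc n}" "j \<in> {..<Suc n}"
    then show "(\<Sum>xs\<in>?L. wt xs * (?W xs)\<^sup>2 * adj (xs ! i) (xs ! j)) = (if i = j then 0 else ?T)"
      using sum_pairs_eq[OF W, of i n j] by (cases "i = j") (simp_all del: One_nat_def)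
  qed
  also have "\<dots> = (\<Sum>i<Suc n. n * ?T)"
  proof (rule sum.cong[OF refl])
    fix i assume "i \<in> {..<Suc n}"
    have "(\<Sum>j<Suc n. if i = j then 0 else ?T) = (\<Sum>j\<in>{..<Suc n} - {i}. ?T)"
      by (rule sum.mono_neutral_cong_right) auto
    then show "(\<Sum>j<Suc n. if i = j then 0 else ?T) = n * ?T"
      using \<open>i \<in> {..<Suc n}\<close> by (simp add: card_Diff_singleton)
  qed
  also have "\<dots> = Suc n * (n * ?T)" by simp
  finally have upper: "2 * ip (Suc n) ?W ?W \<le> Suc n * (n * ?T)" .
  have "?T = (\<Sum>u\<in>V. \<Sum>v\<in>V. \<Sum>\<rho>\<in>lists_of V m. wt (u # v # \<rho>) * (?W (u # v # \<rho>))\<^sup>2 * adj u v)"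
    by (simp add: sum_lists_of_Suc m)
  \<comment> \<open>At an edge the wedge has its two-term form and \<open>adj u v = 1\<close> is at
    most the inner product; at other pairs the left side is 0 and the right side
    nonnegative.\<close>
  also have "\<dots> \<le> (\<Sum>u\<in>V. \<Sum>v\<in>V. \<Sum>\<rho>\<in>lists_of V m.
      wt \<rho> * (1 / (f u * f v) * inner (P u) (P v) * (f u * h (v # \<rho>) - f v * h (u # \<rho>))\<^sup>2))"
  proof (intro sum_mono)
    fix u v \<rho> assume uv: "u \<in> V" "v \<in> V" and "\<rho> \<in> lists_of V m"
    then have "wt \<rho> > 0" by (intro wt_pos) (auto simp: lists_of_def)
    then have nn: "0 \<le> wt \<rho> / (f u * f v) * (f u * h (v # \<rho>) - f v * h (u # \<rho>))\<^sup>2"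
      using f_pos[OF uv(1)] f_pos[OF uv(2)] by simp
    have "wt (u # v # \<rho>) * (?W (u # v # \<rho>))\<^sup>2 * adj u v =
        wt \<rho> / (f u * f v) * (f u * h (v # \<rho>) - f v * h (u # \<rho>))\<^sup>2 * adj u v"
      using wedge_at_edge[of h u v \<rho>, OF supp] by (simp add: adj_def mult_ac)
    also have "\<dots> \<le> wt \<rho> / (f u * f v) * (f u * h (v # \<rho>) - f v * h (u # \<rho>))\<^sup>2 *
        inner (P u) (P v)"
      by (rule mult_left_mono[OF adj_le_inner[OF uv] nn])
    finally show "wt (u # v # \<rho>) * (?W (u # v # \<rho>))\<^sup>2 * adj u v \<le>
        wt \<rho> * (1 / (f u * f v) * inner (P u) (P v) * (f u * h (v # \<rho>) - f v * h (u # \<rho>))\<^sup>2)"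
      by (simp add: mult_ac)
  qed
  also have "\<dots> = (\<Sum>\<rho>\<in>lists_of V m. wt \<rho> * (\<Sum>u\<in>V. \<Sum>v\<in>V.
      1 / (f u * f v) * inner (P u) (P v) * (f u * h (v # \<rho>) - f v * h (u # \<rho>))\<^sup>2))"
    unfolding sum_distrib_left
    by (simp only: sum.swap[of _ "lists_of V m" V])
  \<comment> \<open>\<open>sum_inner_square_le\<close> for each fixed \<open>\<rho>\<close>, with
    \<open>x u = h (u # \<rho>)\<close>.\<close>
  also have "\<dots> \<le> (\<Sum>\<rho>\<in>lists_of V m. wt \<rho> * (2 * (\<Sum>u\<in>V. (h (u # \<rho>))\<^sup>2 / f u * load u)))"
  proof (intro sum_mono mult_left_mono)
    fix \<rho> assume "\<rho> \<in> lists_of V m"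
    then have "wt \<rho> > 0" by (intro wt_pos) (auto simp: lists_of_def)
    then show "0 \<le> wt \<rho>" by simp
  qed (rule sum_inner_square_le)
  also have "\<dots> = 2 * ?D"
    unfolding m sum_lists_of_Suc sum_distrib_left
    by (subst sum.swap) (simp add: mult_ac)
  finally have "?T \<le> 2 * ?D" .
  then have "Suc n * (n * ?T) \<le> Suc n * (n * (2 * ?D))" by (intro mult_left_mono) auto
  then have "2 * ip (Suc n) ?W ?W \<le> Suc n * (n * (2 * ?D))" using upper by linarith
  \<comment> \<open>The 2 from ordered pairs cancels against the 2 in
    \<open>?T \<le> 2 * ?D\<close>. Next \<open>Suc n\<close> cancels, and
    \<open>sum_load_eq\<close> absorbs \<open>n\<close>.\<close>
  then have "real (Suc n) * ((\<Sum>v\<in>V. f v) * ip n h h) \<le> real (Suc n) * (n * ?D)"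
    unfolding ip_wedge_wedge[OF h cyc] by linarith
  then have "(\<Sum>v\<in>V. f v) * ip n h h \<le> n * ?D" by (rule mult_left_le_imp_le) simp
  then show ?thesis unfolding sum_load_eq[OF h] .
qed

end

section \<open>Harmonic representatives\<close>

lemma alternating_chain: "c \<in> carrier (oriented_chains K n) \<Longrightarrow> alternating c"
  by (simp add: chains_carrier_iff alternating_def)

lemma chain_supported:
  assumes "K \<subseteq> Pow V" "c \<in> carrier (oriented_chains K n)" "c xs \<noteq> 0"
  shows "xs \<in> lists_of V n"
  using assms by (auto simp: chains_carrier_iff lists_of_def)

lemma boundary_eq_sum_vertices:
  assumes "finite V" "K \<subseteq> Pow V" "c \<in> carrier (oriented_chains K n)"
  shows "boundary c ys = (\<Sum>v\<in>V. c (v # ys))"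
proof (rule boundary_eq_sum[OF assms(1)])
  show "{v. c (v # ys) \<noteq> 0} \<subseteq> V"
  proof
    fix v assume "v \<in> {v. c (v # ys) \<noteq> 0}"
    then have "set (v # ys) \<in> K" using assms(3) unfolding chains_carrier_iff by blast
    then show "v \<in> V" using assms(2) by auto
  qed
qed

lemma boundaries_add_smult:
  assumes "b \<in> boundaries K n" "d \<in> boundaries K n"
  shows "(\<lambda>xs. b xs + r * d xs) \<in> boundaries K n"
proof -
  obtain b' d' where bd: "b = boundary b'" "d = boundary d'"
    "b' \<in> carrier (oriented_chains K (Suc n))" "d' \<in> carrier (oriented_chains K (Suc n))"
    using assms unfolding boundaries_def by blast
  have "boundary (\<lambda>xs. b' xs + r * d' xs) \<in> boundaries K n"
    unfolding boundaries_def by (rule imageI[OF chains_add[OF bd(3) chains_smult[OF bd(4)]]])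
  then show ?thesis
    by (simp add: bd(1,2) boundary_add[OF bd(3) chains_smult[OF bd(4)]] boundary_smult)
qed

lemma zero_boundaries: "(\<lambda>xs. 0) \<in> boundaries K n"
  unfolding boundaries_def by (rule image_eqI[OF _ chains_zero]) (simp add: boundary_zero)

lemma boundaries_subset_cycles:
  assumes "\<And>S T. S \<in> K \<Longrightarrow> T \<subseteq> S \<Longrightarrow> T \<in> K"
  shows "boundaries K n \<subseteq> cycles K n"
proof
  fix b assume "b \<in> boundaries K n"
  then obtain c where c: "c \<in> carrier (oriented_chains K (Suc n))" "b = boundary c"
    unfolding boundaries_def by blast
  show "b \<in> cycles K n"
    using boundary_chain[OF c(1) assms] boundary_boundary[OF c(1)] c(2) by (simp add: cycles_def)
qed

lemma homology_carrier_iff: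
  "X \<in> carrier (reduced_homology K k) \<longleftrightarrow>
    (\<exists>z\<in>cycles K (k + 1). X = {\<lambda>xs. b xs + z xs |b. b \<in> boundaries K (k + 1)})"
  by (auto simp: reduced_homology_def quotient_module_def A_RCOSETS_def' a_r_coset_def')

lemma homology_add_mem:
  assumes "x \<in> X" "y \<in> Y"
  shows "(\<lambda>xs. x xs + y xs) \<in> X \<oplus>\<^bsub>reduced_homology K k\<^esub> Y"
  using assms by (auto simp: reduced_homology_def quotient_module_def set_add_def')

lemma homology_smult_mem:
  assumes "x \<in> X"
  shows "(\<lambda>xs. r * x xs) \<in> r \<odot>\<^bsub>reduced_homology K k\<^esub> X"
proof -
  have "(\<lambda>xs. r * x xs) \<in> (\<Union>x\<in>X. \<Union>b\<in>boundaries K (k + 1). {\<lambda>xs. b xs + r * x xs})"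
    using assms zero_boundaries by (intro UN_I[of x] UN_I[of "\<lambda>xs. 0"]) auto
  then show ?thesis by (simp add: reduced_homology_def quotient_module_def a_r_coset_def')
qed

context weighted_vertices
begin

lemma ip_add_smult_left: "ip n (\<lambda>xs. c xs + r * d xs) e = ip n c e + r * ip n d e"
  unfolding ip_def sum_distrib_left sum.distrib[symmetric]
  by (rule sum.cong[OF refl]) (simp add: algebra_simps)

lemma ip_add_smult_right: "ip n e (\<lambda>xs. c xs + r * d xs) = ip n e c + r * ip n e d"
  unfolding ip_def sum_distrib_left sum.distrib[symmetric]
  by (rule sum.cong[OF refl]) (simp add: algebra_simps)

text \<open>Induction on the support: \<open>U\<close> is the part of \<open>W\<close> vanishing at
  \<open>s\<close>. If it is proper, subtracting from some \<open>w0\<close> its projection to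
  \<open>U\<close> gives an \<open>e\<close> orthogonal to \<open>U\<close>, and the projection to
  \<open>W\<close> is the one to \<open>U\<close> corrected along \<open>e\<close>.\<close>

lemma orthogonal_projection:
  assumes "finite F" "F \<subseteq> lists_of V n" "(\<lambda>xs. 0) \<in> W"
    and "\<And>c d r. c \<in> W \<Longrightarrow> d \<in> W \<Longrightarrow> (\<lambda>xs. c xs + r * d xs) \<in> W"
    and "\<And>c xs. c \<in> W \<Longrightarrow> c xs \<noteq> 0 \<Longrightarrow> xs \<in> F"
  shows "\<exists>w\<in>W. \<forall>b\<in>W. ip n (\<lambda>xs. x xs + (-1) * w xs) b = 0"
  using assms
proof (induction F arbitrary: W x)
  case empty
  then have "W \<subseteq> {\<lambda>xs. 0}" by blast
  then show ?case using empty.prems(2) by (intro bexI[of _ "\<lambda>xs. 0"]) (auto simp: ip_def)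
next
  case (insert s F)
  note W0 = insert.prems(2) and W = insert.prems(3)
  define U where "U = {w \<in> W. w s = 0}"
  have proj: "\<exists>w\<in>U. \<forall>b\<in>U. ip n (\<lambda>xs. x xs + (-1) * w xs) b = 0" for x
  proof (rule insert.IH)
    fix c xs assume "c \<in> U" "c xs \<noteq> 0"
    then show "xs \<in> F" using insert.prems(4)[of c xs] unfolding U_def by auto
  qed (use insert.prems in \<open>auto simp: U_def\<close>)
  show ?case
  proof (cases "U = W")
    case True
    then show ?thesis using proj by simp
  next
    case False
    then obtain w0 where w0: "w0 \<in> W" "w0 s \<noteq> 0" unfolding U_def by blast
    obtain p where p: "p \<in> U" "\<And>b. b \<in> U \<Longrightarrow> ip n (\<lambda>xs. w0 xs + (-1) * p xs) b = 0"
      using proj[of w0] by blast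
    define e where "e = (\<lambda>xs. w0 xs + (-1) * p xs)"
    have e: "e \<in> W" "e s \<noteq> 0" and eU: "\<And>b. b \<in> U \<Longrightarrow> ip n e b = 0"
      using W[OF w0(1), of p "-1"] p w0(2) by (auto simp: e_def U_def)
    have ee: "ip n e e \<noteq> 0"
      using ip_self_eq_0[of n e s] e(2) insert.prems(1) by (auto simp: lists_of_def)
    obtain q where q: "q \<in> U" "\<And>b. b \<in> U \<Longrightarrow> ip n (\<lambda>xs. x xs + (-1) * q xs) b = 0"
      using proj[of x] by blast
    \<comment> \<open>This coefficient makes the remainder orthogonal to \<open>e\<close> and leaves
      it orthogonal to \<open>U\<close>.\<close>
    define t where "t = ip n (\<lambda>xs. x xs + (-1) * q xs) e / ip n e e"
    define w where "w = (\<lambda>xs. q xs + t * e xs)"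
    have split: "ip n (\<lambda>xs. x xs + (-1) * w xs) b =
        ip n (\<lambda>xs. x xs + (-1) * q xs) b - t * ip n e b" for b
      unfolding w_def ip_add_smult_left by simp
    have "ip n (\<lambda>xs. x xs + (-1) * w xs) b = 0" if b: "b \<in> W" for b
    proof -
      \<comment> \<open>The multiple of \<open>e\<close> in \<open>b\<close> is read off at
        \<open>s\<close>: \<open>b'\<close> vanishes there, hence lies in \<open>U\<close>.\<close>
      define b' where "b' = (\<lambda>xs. b xs + (- (b s / e s)) * e xs)"
      have b': "b' \<in> U" using W[OF b e(1), of "- (b s / e s)"] e(2) by (simp add: b'_def U_def)
      have "b = (\<lambda>xs. b' xs + (b s / e s) * e xs)" by (simp add: b'_def)
      then have "ip n (\<lambda>xs. x xs + (-1) * w xs) b = ip n (\<lambda>xs. x xs + (-1) * w xs) b' +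
          (b s / e s) * ip n (\<lambda>xs. x xs + (-1) * w xs) e"
        using ip_add_smult_right by metis
      also have "ip n (\<lambda>xs. x xs + (-1) * w xs) b' = 0"
        unfolding split using q(2)[OF b'] eU[OF b'] by simp
      also have "ip n (\<lambda>xs. x xs + (-1) * w xs) e = 0"
        unfolding split using ee by (simp add: t_def)
      finally show ?thesis by simp
    qed
    moreover have "w \<in> W" unfolding w_def by (rule W) (use q e in \<open>auto simp: U_def\<close>)
    ultimately show ?thesis by blast
  qed
qed

lemma chain_eq_0:
  assumes K: "K \<subseteq> Pow V" and c: "c \<in> carrier (oriented_chains K n)" and "ip n c c = 0"
  shows "c = (\<lambda>xs. 0)"
proof
  fix xs show "c xs = 0"
    using chain_supported[OF K c, of xs] ip_self_eq_0[OF assms(3), of xs]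
    by (auto simp: lists_of_def)
qed

text \<open>Orthogonality to the boundaries stands for annihilation by the adjoint boundary, which
  \<open>harmonic_wedge_eq_0\<close> recovers.\<close>

definition harmonic :: "'a set set \<Rightarrow> nat \<Rightarrow> ('a list \<Rightarrow> real) \<Rightarrow> bool" where
  "harmonic K n h \<longleftrightarrow> h \<in> cycles K n \<and> (\<forall>b\<in>boundaries K n. ip n h b = 0)"

text \<open>Let \<open>c\<close> be the wedge restricted to the simplices of \<open>K\<close>. Its
  pairing with the wedge is its own squared norm and, by adjointness, also a multiple of the pairing
  of \<open>boundary c\<close> with \<open>h\<close>, which is 0.\<close>

lemma harmonic_wedge_eq_0:
  assumes K: "K \<subseteq> Pow V" and h: "harmonic K n h"
    and xs: "xs \<in> lists_of V (Suc n)" "set xs \<in> K"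
  shows "wedge f h xs = 0"
proof (cases "distinct xs")
  case True
  have hc: "h \<in> carrier (oriented_chains K n)" using h by (simp add: harmonic_def cycles_def)
  note W = alternating_wedge[OF alternating_chain[OF hc], of f]
  define c where "c = (\<lambda>xs. if xs \<in> lists_of V (Suc n) \<and> distinct xs \<and> set xs \<in> K
    then wedge f h xs else 0)"
  have c: "c \<in> carrier (oriented_chains K (Suc n))"
    unfolding chains_carrier_iff
  proof (intro conjI allI impI)
    show "finite {xs. c xs \<noteq> 0}"
      by (rule finite_subset[OF _ finite_lists_of[OF finite_V, of "Suc n"]]) (auto simp: c_def)
    show "c (permute_list p xs) = of_int (sign p) * c xs" if "p permutes {..<length xs}" for p xs
      using that alternatingD[OF W that] by (simp add: c_def lists_of_def)
  qed (auto simp: c_def lists_of_def split: if_splits)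
  then have b: "boundary c \<in> boundaries K n" by (simp add: boundaries_def)
  have "ip (Suc n) c (wedge f h) = Suc n * ip n (boundary c) h"
    unfolding ip_wedge[OF alternating_chain[OF c]] ip_cone
      boundary_eq_sum_vertices[OF finite_V K c, abs_def] ..
  also have "\<dots> = 0" using h b by (simp add: harmonic_def ip_commute[of n "boundary c"])
  also have "ip (Suc n) c (wedge f h) = ip (Suc n) c c"
    unfolding ip_def by (rule sum.cong) (auto simp: c_def)
  finally have "c = (\<lambda>xs. 0)" by (rule chain_eq_0[OF K c])
  then show ?thesis using xs True by (metis c_def)
qed (rule alternating_not_distinct, rule alternating_wedge, rule alternating_chain,
    use h in \<open>auto simp: harmonic_def cycles_def\<close>)

text \<open>A cycle minus its orthogonal projection to the boundaries gives existence. Two harmonic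
  members of one class differ by a boundary that is orthogonal to itself.\<close>

lemma harmonic_representative:
  assumes K: "K \<subseteq> Pow V" and down: "\<And>S T. S \<in> K \<Longrightarrow> T \<subseteq> S \<Longrightarrow> T \<in> K"
    and X: "X \<in> carrier (reduced_homology K k)"
  shows "\<exists>!h. h \<in> X \<and> harmonic K (k + 1) h"
proof -
  let ?B = "boundaries K (k + 1)" and ?Z = "cycles K (k + 1)"
  have BZ: "?B \<subseteq> ?Z" by (rule boundaries_subset_cycles[OF down])
  obtain z where z: "z \<in> ?Z" "X = {\<lambda>xs. b xs + z xs |b. b \<in> ?B}"
    using X unfolding homology_carrier_iff by blast
  have Badd: "\<And>b d r. b \<in> ?B \<Longrightarrow> d \<in> ?B \<Longrightarrow> (\<lambda>xs. b xs + r * d xs) \<in> ?B"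
    by (rule boundaries_add_smult)
  have "\<exists>w\<in>?B. \<forall>b\<in>?B. ip (k + 1) (\<lambda>xs. z xs + (-1) * w xs) b = 0"
  proof (rule orthogonal_projection[OF _ order_refl zero_boundaries Badd])
    show "finite (lists_of V (k + 1))" using finite_V by simp
    fix c xs assume "c \<in> ?B" "c xs \<noteq> 0"
    then show "xs \<in> lists_of V (k + 1)"
      using BZ by (intro chain_supported[OF K, of c]) (auto simp: cycles_def)
  qed
  then obtain w where w: "w \<in> ?B" "\<forall>b\<in>?B. ip (k + 1) (\<lambda>xs. z xs + (-1) * w xs) b = 0" by blast
  define h where "h = (\<lambda>xs. z xs + (-1) * w xs)"
  have wz: "w \<in> ?Z" using w BZ by blast
  have "h \<in> ?Z"
  proof -
    have zc: "z \<in> carrier (oriented_chains K (k + 1))" "boundary z = (\<lambda>xs. 0)"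
      and wc: "w \<in> carrier (oriented_chains K (k + 1))" "boundary w = (\<lambda>xs. 0)"
      using z(1) wz by (auto simp: cycles_def)
    show ?thesis unfolding h_def cycles_def mem_Collect_eq
      using chains_add[OF zc(1) chains_smult[OF wc(1), of "-1"]]
        boundary_add[OF zc(1) chains_smult[OF wc(1), of "-1"]]
      by (simp add: boundary_smult[of "-1" w, simplified] zc(2) wc(2))
  qed
  then have h: "harmonic K (k + 1) h" using w by (simp add: harmonic_def h_def)
  have "h = (\<lambda>xs. ((\<lambda>xs. 0) xs + (-1) * w xs) + z xs)" by (simp add: h_def)
  then have hX: "h \<in> X"
    unfolding z(2) using Badd[OF zero_boundaries w(1), of "-1"] by (intro CollectI exI conjI)
  have "h' = h" if h': "h' \<in> X" "harmonic K (k + 1) h'" for h'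
  proof -
    obtain b b' where b: "h = (\<lambda>xs. b xs + z xs)" "h' = (\<lambda>xs. b' xs + z xs)" "b \<in> ?B" "b' \<in> ?B"
      using hX h'(1) z(2) by auto
    let ?d = "\<lambda>xs. h' xs + (-1) * h xs"
    have d: "?d \<in> ?B" using Badd[OF b(4,3), of "-1"] b by simp
    then have "ip (k + 1) h ?d = 0" "ip (k + 1) h' ?d = 0"
      using h h' unfolding harmonic_def by blast+
    then have "ip (k + 1) ?d ?d = 0" unfolding ip_add_smult_left by simp
    moreover have "?d \<in> carrier (oriented_chains K (k + 1))"
      using d BZ by (auto simp: cycles_def)
    ultimately have "?d = (\<lambda>xs. 0)" using chain_eq_0[OF K] by blast
    then show ?thesis by (simp add: fun_eq_iff)
  qed
  then show ?thesis using h hX by blast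
qed

lemma harmonic_add_smult:
  assumes "harmonic K n c" "harmonic K n d"
  shows "harmonic K n (\<lambda>xs. c xs + r * d xs)"
proof -
  have c: "c \<in> carrier (oriented_chains K n)" "boundary c = (\<lambda>xs. 0)"
    and d: "d \<in> carrier (oriented_chains K n)" "boundary d = (\<lambda>xs. 0)"
    using assms by (auto simp: harmonic_def cycles_def)
  then show ?thesis
    using assms chains_add[OF c(1) chains_smult[OF d(1)]]
      boundary_add[OF c(1) chains_smult[OF d(1)]]
    by (simp add: harmonic_def cycles_def boundary_smult ip_add_smult_left)
qed

lemma harmonic_zero: "harmonic K n (\<lambda>xs. 0)"
  by (simp add: harmonic_def cycles_def chains_zero boundary_zero ip_def)

text \<open>The harmonic representative depends linearly on the class, so its values at the sets in
  \<open>S\<close> are linear functionals on homology, and \<open>sep\<close> makes them separate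
  points.\<close>

lemma dim_homology_le:
  assumes K: "K \<subseteq> Pow V" and down: "\<And>S T. S \<in> K \<Longrightarrow> T \<subseteq> S \<Longrightarrow> T \<in> K"
    and S: "finite S"
    and sep: "\<And>h. harmonic K (k + 1) h \<Longrightarrow> (\<And>xs. set xs \<in> S \<Longrightarrow> h xs = 0) \<Longrightarrow> h = (\<lambda>xs. 0)"
  shows "vectorspace.dim class_ring (reduced_homology K k) \<le> card S"
proof -
  let ?Q = "reduced_homology K k"
  interpret Q: vectorspace class_ring ?Q by (rule reduced_homology_vectorspace[OF down])
  define H where "H X = (THE h. h \<in> X \<and> harmonic K (k + 1) h)" for X
  have H: "H X \<in> X" "harmonic K (k + 1) (H X)" if "X \<in> carrier ?Q" for X
    using theI'[OF harmonic_representative[OF K down that]] by (auto simp: H_def)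
  have H_eqI: "H X = h" if "X \<in> carrier ?Q" "h \<in> X" "harmonic K (k + 1) h" for X h
    unfolding H_def by (rule the1_equality[OF harmonic_representative[OF K down]]) (use that in auto)
  have H_add: "H (X \<oplus>\<^bsub>?Q\<^esub> Y) = (\<lambda>xs. H X xs + H Y xs)"
    if "X \<in> carrier ?Q" "Y \<in> carrier ?Q" for X Y
    using that H[OF that(1)] H[OF that(2)] harmonic_add_smult[of K "k + 1" "H X" "H Y" 1]
    by (intro H_eqI homology_add_mem) simp_all
  have H_smult: "H (r \<odot>\<^bsub>?Q\<^esub> X) = (\<lambda>xs. r * H X xs)" if "X \<in> carrier ?Q" for r X
    using that H[OF that] harmonic_add_smult[OF harmonic_zero H(2)[OF that], of r]
    by (intro H_eqI homology_smult_mem) simp_all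
  \<comment> \<open>One ordering per set suffices, since alternation determines the values at the
    others.\<close>
  define enum where "enum I = (SOME xs. set xs = I \<and> distinct xs)" for I :: "'a set"
  have enum: "set (enum I) = I \<and> distinct (enum I)" if "finite I" for I
    unfolding enum_def using finite_distinct_list[OF that] by (rule someI_ex)
  show ?thesis
  proof (rule Q.dim_le_card_separating[where l = "\<lambda>I X. H X (enum I)", OF S])
    fix X assume X: "X \<in> carrier ?Q" and 0: "\<And>I. I \<in> S \<Longrightarrow> H X (enum I) = \<zero>\<^bsub>class_ring\<^esub>"
    have hc: "H X \<in> carrier (oriented_chains K (k + 1))"
      using H(2)[OF X] by (simp add: harmonic_def cycles_def)
    have "H X xs = 0" if xs: "set xs \<in> S" for xs
    proof (cases "distinct xs")
      case True
      then have "mset xs = mset (enum (set xs))" using enum[of "set xs"]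
        by (simp add: set_eq_iff_mset_eq_distinct[symmetric])
      then obtain p where "p permutes {..<length (enum (set xs))}"
        "permute_list p (enum (set xs)) = xs" by (rule mset_eq_permutation)
      then show ?thesis
        using alternatingD[OF alternating_chain[OF hc], of p "enum (set xs)"] 0[OF xs] by simp
    qed (rule alternating_not_distinct[OF alternating_chain[OF hc]])
    then have "H X = (\<lambda>xs. 0)" by (rule sep[OF H(2)[OF X]])
    moreover have "(\<lambda>xs. 0) \<in> \<zero>\<^bsub>?Q\<^esub>"
      using zero_boundaries by (simp add: reduced_homology_def quotient_module_def)
    ultimately have "(\<lambda>xs. 0) \<in> X" using H(1)[OF X] by simp
    then obtain z b where z: "z \<in> cycles K (k + 1)" "b \<in> boundaries K (k + 1)"
      "(\<lambda>xs. 0) = (\<lambda>xs. b xs + z xs)"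
      "X = {\<lambda>xs. b xs + z xs |b. b \<in> boundaries K (k + 1)}"
      using X unfolding homology_carrier_iff by blast
    have zb: "z xs = - b xs" for xs using fun_cong[OF z(3), of xs] by simp
    \<comment> \<open>The zero class is the subgroup of boundaries itself, and \<open>X\<close> is a
      coset of it containing the zero chain.\<close>
    have "X = boundaries K (k + 1)"
    proof (intro equalityI subsetI)
      fix x assume "x \<in> X"
      then obtain d where "d \<in> boundaries K (k + 1)" "x = (\<lambda>xs. d xs + (-1) * b xs)"
        using z(4) zb by auto
      then show "x \<in> boundaries K (k + 1)" using boundaries_add_smult z(2) by blast
    next
      fix x assume "x \<in> boundaries K (k + 1)"
      then have "(\<lambda>xs. x xs + 1 * b xs) \<in> boundaries K (k + 1)"
        using boundaries_add_smult z(2) by blast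
      moreover have "x = (\<lambda>xs. (x xs + 1 * b xs) + z xs)" using zb by simp
      ultimately show "x \<in> X" unfolding z(4) by (intro CollectI exI conjI)
    qed
    then show "X = \<zero>\<^bsub>?Q\<^esub>" by (simp add: reduced_homology_def quotient_module_def)
  qed (simp_all add: H_add H_smult)
qed

end

section \<open>The dimension bound for strictly positive weights\<close>

context weighted_representation
begin

text \<open>A harmonic \<open>h\<close> vanishing on \<open>?S\<close> lives on sets whose total
  load is below the total weight, so any nonzero value would contradict
  \<open>harmonic_inequality\<close>.\<close>

lemma dim_independence_homology_le:
  "vectorspace.dim class_ring (reduced_homology (independence_complex V E) k)
    \<le> card {I. I \<subseteq> V \<and> card I = k + 1 \<and> (\<Sum>v\<in>V. f v) \<le> (\<Sum>u\<in>I. load u)}"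
    (is "_ \<le> card ?S")
proof (rule dim_homology_le)
  let ?K = "independence_complex V E"
  show K: "?K \<subseteq> Pow V" by (auto simp: independence_complex_def)
  show "T \<in> ?K" if "U \<in> ?K" "T \<subseteq> U" for U T using that by (auto simp: independence_complex_def)
  show "finite ?S" using finite_V by simp
  fix h assume h: "harmonic ?K (k + 1) h" and 0: "\<And>xs. set xs \<in> ?S \<Longrightarrow> h xs = 0"
  let ?L = "lists_of V (k + 1)"
  have hc: "h \<in> carrier (oriented_chains ?K (k + 1))" and bd: "boundary h = (\<lambda>xs. 0)"
    using h by (auto simp: harmonic_def cycles_def)
  let ?t = "\<lambda>xs. wt xs * (h xs)\<^sup>2 * ((\<Sum>v\<in>V. f v) - (\<Sum>u\<in>set xs. load u))"
  have lt: "(\<Sum>u\<in>set xs. load u) < (\<Sum>v\<in>V. f v)" if "h xs \<noteq> 0" for xs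
  proof -
    have "length xs = k + 1" "distinct xs" "set xs \<in> ?K"
      using hc that unfolding chains_carrier_iff by blast+
    then have "set xs \<subseteq> V" "card (set xs) = k + 1" using K by (auto simp: distinct_card)
    then have "\<not> (\<Sum>v\<in>V. f v) \<le> (\<Sum>u\<in>set xs. load u)" using 0[of xs] that by blast
    then show ?thesis by simp
  qed
  have wp: "wt xs > 0" if "xs \<in> ?L" for xs using wt_pos that by (simp add: lists_of_def)
  have nn: "0 \<le> ?t xs" if "xs \<in> ?L" for xs
    using wp[OF that] lt[of xs] by (cases "h xs = 0") auto
  have "(\<Sum>v\<in>V. f v) * ip (k + 1) h h \<le> (\<Sum>xs\<in>?L. wt xs * (h xs)\<^sup>2 * (\<Sum>u\<in>set xs. load u))"
  proof (rule harmonic_inequality[OF alternating_chain[OF hc]])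
    show "(\<Sum>v\<in>V. h (v # zs)) = 0" for zs
      using boundary_eq_sum_vertices[OF finite_V K hc, of zs] bd by simp
    show "set xs \<in> ?K" if "h xs \<noteq> 0" for xs
      using hc that unfolding chains_carrier_iff by blast
  qed (use harmonic_wedge_eq_0[OF K h] in auto)
  then have "(\<Sum>xs\<in>?L. ?t xs) \<le> 0"
    by (simp add: ip_def right_diff_distrib sum_subtractf sum_distrib_left power2_eq_square mult_ac)
  then have "(\<Sum>xs\<in>?L. ?t xs) = 0" using sum_nonneg[of ?L ?t] nn by fastforce
  then have t0: "?t xs = 0" if "xs \<in> ?L" for xs
    using sum_nonneg_eq_0_iff[of ?L ?t, OF finite_lists_of[OF finite_V] nn] that by blast
  show "h = (\<lambda>xs. 0)"
  proof
    fix xs show "h xs = 0"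
    proof (rule ccontr)
      assume nz: "h xs \<noteq> 0"
      then have "xs \<in> ?L" by (rule chain_supported[OF K hc])
      then show False using t0[of xs] wp[of xs] lt[OF nz] nz by simp
    qed
  qed
qed

end

section \<open>Perturbation to nonnegative weights\<close>

theorem theorem1p7:
  fixes V :: "'a set" and E :: "'a set set"
    and P :: "'a \<Rightarrow> real ^ 'l" and f :: "'a \<Rightarrow> real" and k :: nat
  assumes "simple_graph V E"
    and "vector_representation V E P"
    and "\<And>v. v \<in> V \<Longrightarrow> f v \<ge> 0"
  shows "vectorspace.dim class_ring (reduced_homology (independence_complex V E) k)
    \<le> card {I. I \<subseteq> V \<and> card I = k + 1 \<and>
        inner (\<Sum>u\<in>I. P u) (\<Sum>v\<in>V. f v *\<^sub>R P v) \<ge> (\<Sum>v\<in>V. f v)}"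
proof -
  let ?gap = "\<lambda>\<epsilon> I. inner (\<Sum>u\<in>I. P u) (\<Sum>v\<in>V. (f v + \<epsilon>) *\<^sub>R P v) - (\<Sum>v\<in>V. f v + \<epsilon>)"
  have fin: "finite V" using assms(1) by (simp add: simple_graph_def)
  \<comment> \<open>A set with negative gap fails the counting inequality. As \<open>V\<close> has
    finitely many subsets, one small \<open>\<epsilon>\<close> preserves all these strict failures,
    so no new set is counted for \<open>f + \<epsilon>\<close>.\<close>
  have "\<forall>\<^sub>F \<epsilon> in at_right 0. \<forall>I\<in>{I \<in> Pow V. ?gap 0 I < 0}. ?gap \<epsilon> I < 0"
  proof (rule eventually_ball_finite)
    show "finite {I \<in> Pow V. ?gap 0 I < 0}" using fin by simp
    have "((\<lambda>\<epsilon>. ?gap \<epsilon> I) \<longlongrightarrow> ?gap 0 I) (at_right 0)" for I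
      by (intro tendsto_intros)
    from order_tendstoD(2)[OF this]
    show "\<forall>I\<in>{I \<in> Pow V. ?gap 0 I < 0}. \<forall>\<^sub>F \<epsilon> in at_right 0. ?gap \<epsilon> I < 0"
      by blast
  qed
  moreover have "\<forall>\<^sub>F \<epsilon> in at_right 0. (0::real) < \<epsilon>" by (rule eventually_at_right_less)
  ultimately have "\<forall>\<^sub>F \<epsilon> in at_right 0. 0 < \<epsilon> \<and> (\<forall>I\<in>{I \<in> Pow V. ?gap 0 I < 0}. ?gap \<epsilon> I < 0)"
    by eventually_elim blast
  then have "\<exists>\<epsilon>. 0 < \<epsilon> \<and> (\<forall>I\<in>{I \<in> Pow V. ?gap 0 I < 0}. ?gap \<epsilon> I < 0)"
    by (rule eventually_happens'[OF trivial_limit_at_right_real])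
  then obtain \<epsilon> where \<epsilon>: "0 < \<epsilon>" "\<forall>I\<in>{I \<in> Pow V. ?gap 0 I < 0}. ?gap \<epsilon> I < 0"
    by (elim exE conjE)
  interpret weighted_representation V "\<lambda>v. f v + \<epsilon>" E P
  proof
    show "0 < f v + \<epsilon>" if "v \<in> V" for v using assms(3)[OF that] \<epsilon>(1) by linarith
    show "card e = 2" if "e \<in> E" for e using assms(1) that by (simp add: simple_graph_def)
    fix u v assume uv: "u \<in> V" "v \<in> V"
    show "1 \<le> inner (P u) (P v)" if "{u, v} \<in> E"
      using assms(2) uv that unfolding vector_representation_def by metis
    show "0 \<le> inner (P u) (P v)"
      using assms(2) uv unfolding vector_representation_def
      by (metis order_trans zero_le_one)
  qed (rule fin)
  have load: "(\<Sum>u\<in>I. load u) = inner (\<Sum>u\<in>I. P u) (\<Sum>v\<in>V. (f v + \<epsilon>) *\<^sub>R P v)" for I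
    by (simp add: load_def inner_sum_left)
  have "inner (\<Sum>u\<in>I. P u) (\<Sum>v\<in>V. f v *\<^sub>R P v) \<ge> (\<Sum>v\<in>V. f v)"
    if "I \<subseteq> V" "(\<Sum>v\<in>V. f v + \<epsilon>) \<le> (\<Sum>u\<in>I. load u)" for I
  proof (rule ccontr)
    assume "\<not> inner (\<Sum>u\<in>I. P u) (\<Sum>v\<in>V. f v *\<^sub>R P v) \<ge> (\<Sum>v\<in>V. f v)"
    then have "?gap 0 I < 0" by simp
    then have "?gap \<epsilon> I < 0" using \<epsilon>(2) that(1) by blast
    then show False using that(2) unfolding load by linarith
  qed
  then have "{I. I \<subseteq> V \<and> card I = k + 1 \<and> (\<Sum>v\<in>V. f v + \<epsilon>) \<le> (\<Sum>u\<in>I. load u)} \<subseteq>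
      {I. I \<subseteq> V \<and> card I = k + 1 \<and>
        inner (\<Sum>u\<in>I. P u) (\<Sum>v\<in>V. f v *\<^sub>R P v) \<ge> (\<Sum>v\<in>V. f v)}"
    by blast
  then have "card {I. I \<subseteq> V \<and> card I = k + 1 \<and> (\<Sum>v\<in>V. f v + \<epsilon>) \<le> (\<Sum>u\<in>I. load u)} \<le>
      card {I. I \<subseteq> V \<and> card I = k + 1 \<and>
        inner (\<Sum>u\<in>I. P u) (\<Sum>v\<in>V. f v *\<^sub>R P v) \<ge> (\<Sum>v\<in>V. f v)}"
    by (rule card_mono[rotated]) (use fin in simp)
  then show ?thesis using dim_independence_homology_le[of k] by linarith
qed

end
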